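(* (i) For every $M>0$ there exists a finite family of lines in $\mathbb{R}^3$ whose disjointness graph $G$ satisfies $\chi(G)/\omega(G)> M$. (ii) For every positive integer $k$ there is a finite family of lines in $\mathbb{P}^3$ whose disjointness graph $G$ satisfies $\omega(G)=k$ and $\chi(G)=2k-1$.
   Context: The disjointness graph of a set of lines is the graph whose vertices are the lines, two adjacent iff they are disjoint. $\chi$ and $\omega$ denote chromatic number and clique number; $\mathbb{P}^3$ is real projective 3-space. *)

theory Defs
  imports "HOL-Analysis.Analysis" "HOL-Library.Ramsey"
begin

text \<open>
  A simple graph is given by a vertex set \<open>V\<close> and a set \<open>E\<close> of two-element edges, the convention of
  \<^const>\<open>clique\<close>. Both numbers below are meant for finite \<open>V\<close>.
\<close>

definition proper_colouring :: "'a set \<Rightarrow> 'a set set \<Rightarrow> nat \<Rightarrow> ('a \<Rightarrow> nat) \<Rightarrow> bool" where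
  "proper_colouring V E n c \<longleftrightarrow>
     c ` V \<subseteq> {..<n} \<and> (\<forall>v\<in>V. \<forall>w\<in>V. {v, w} \<in> E \<longrightarrow> c v \<noteq> c w)"

definition chromatic_number :: "'a set \<Rightarrow> 'a set set \<Rightarrow> nat" where
  "chromatic_number V E = (LEAST n. \<exists>c. proper_colouring V E n c)"

definition clique_number :: "'a set \<Rightarrow> 'a set set \<Rightarrow> nat" where
  "clique_number V E = Max {card K | K. K \<subseteq> V \<and> clique K E}"

definition disjointness_edges :: "'p set set \<Rightarrow> 'p set set set" where
  "disjointness_edges F = {{L, M} | L M. L \<in> F \<and> M \<in> F \<and> L \<noteq> M \<and> disjnt L M}"

definition affine_line :: "'v::euclidean_space set \<Rightarrow> bool" where
  "affine_line L \<longleftrightarrow> affine L \<and> aff_dim L = 1"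

text \<open>
  The projective space \<open>P(V)\<close> of a real vector space \<open>V\<close>: its points are the one-dimensional linear
  subspaces of \<open>V\<close>, and a line is the set of all points lying in some fixed two-dimensional linear
  subspace. Projective 3-space is the case \<open>V = real ^ 4\<close>.
\<close>

definition projective_points :: "'v::euclidean_space set set" where
  "projective_points = {p. subspace p \<and> dim p = 1}"

definition projective_line :: "'v::euclidean_space set set \<Rightarrow> bool" where
  "projective_line L \<longleftrightarrow>
     (\<exists>W. subspace W \<and> dim W = 2 \<and> L = {p \<in> projective_points. p \<subseteq> W})"

end

theory Submission
  imports Defs
begin

text \<open>
  (i) Combinatorial lines of \<open>[k]\<^sup>n\<close>, drawn as straight lines and mapped generically to
  \<open>\<real>\<^sup>3\<close>, meet only in points of the grid. Each contains \<open>k\<close> grid points, so at most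
  \<open>k\<^sup>n / k\<close> of them are pairwise disjoint. Pairwise meeting lines are hit by two grid points, so
  \<open>q\<close> colours give \<open>2 q\<close> grid points meeting every line; by the density Hales--Jewett theorem these
  are more than half of the grid. Hence the ratio exceeds \<open>k / 4\<close>.

  Density Hales--Jewett is proved by induction on the number of letters, along the lines of Dodos,
  Kanellopoulos and Tyros. A line-free set over \<open>[k+1]\<close> of extremal density avoids an intersection
  of \<open>k\<close> sets, the \<open>i\<close>-th of which does not distinguish \<open>i\<close> from \<open>k\<close>; by the theorem over \<open>[k]\<close>
  the intersection has positive density. Its complement is a union of intersections of such
  insensitive sets, hence, again by the theorem over \<open>[k]\<close>, almost tiled by large subspaces. On each
  of them the set has at most the extremal density, which leaves too little in total.

  (ii) The lines through pairs of \<open>2k + 1\<close> points in general position meet if and only if the pairs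
  do, so the disjointness graph is the Kneser graph of pairs.
\<close>

subsection \<open>Words and combinatorial subspaces\<close>

text \<open>Words over \<open>[k]\<close> are a vanishing fraction of \<open>[k+1]^n\<close>, so a
  dense set over \<open>[k+1]\<close> need not contain any of them and the theorem over
  \<open>[k]\<close> does not apply to it directly. This obstacle is met in two ways. For
  insensitive sets, the variables are surrounded by fixed letters, which may be \<open>k\<close>, so
  that the average over parameters below \<open>k\<close> is at least the average over the whole
  cube up to a small error. For the line-free set, extremality makes every section by a short prefix
  almost as dense as the set itself; prefixes may then be built by any rule, and
  \<open>blocks\<close> is a rule that turns lines over \<open>[k]\<close> into lines over
  \<open>[k+1]\<close>. The tiling results bound sums of a real function, because they are applied
  to an indicator minus a constant. In (ii), pairs from \<open>n\<close> points give clique number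
  floor(n / 2) and chromatic number \<open>n - 2\<close>; the choice \<open>n = 2 * k + 1\<close>
  turns these into \<open>k\<close> and \<open>2 * k - 1\<close>.\<close>

definition words :: "'a set \<Rightarrow> nat \<Rightarrow> 'a list set" where
  "words X n = {xs. set xs \<subseteq> X \<and> length xs = n}"

lemma finite_words [simp]: "finite X \<Longrightarrow> finite (words X n)"
  unfolding words_def by (rule finite_lists_length_eq)

lemma card_words: "finite X \<Longrightarrow> card (words X n) = card X ^ n"
  unfolding words_def by (rule card_lists_length_eq)

lemma words_0 [simp]: "words X 0 = {[]}"
  by (auto simp: words_def)

lemma words_length: "w \<in> words X n \<Longrightarrow> length w = n"
  by (simp add: words_def)

lemma words_nth: "w \<in> words X n \<Longrightarrow> j < n \<Longrightarrow> w ! j \<in> X"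
  by (auto simp: words_def)

lemma words_append: "x \<in> words X a \<Longrightarrow> y \<in> words X b \<Longrightarrow> x @ y \<in> words X (a + b)"
  by (auto simp: words_def)

lemma sum_words_append:
  "(\<Sum>w\<in>words X (a + b). f w) = (\<Sum>x\<in>words X a. \<Sum>y\<in>words X b. f (x @ y))"
proof -
  have "bij_betw (\<lambda>(x, y). x @ y) (words X a \<times> words X b) (words X (a + b))"
  proof (rule bij_betwI[where g = "\<lambda>w. (take a w, drop a w)"])
    show "(\<lambda>w. (take a w, drop a w)) \<in> words X (a + b) \<rightarrow> words X a \<times> words X b"
      by (auto simp: words_def dest: in_set_takeD in_set_dropD)
  qed (auto simp: words_def)
  then have "(\<Sum>w\<in>words X (a + b). f w) = (\<Sum>p\<in>words X a \<times> words X b. f (case p of (x, y) \<Rightarrow> x @ y))"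
    by (rule sum.reindex_bij_betw[symmetric])
  then show ?thesis
    by (simp add: sum.cartesian_product split_def)
qed

lemma sum_words_1: "(\<Sum>w\<in>words X (Suc 0). f w) = (\<Sum>x\<in>X. f [x])"
proof -
  have "words X (Suc 0) = (\<lambda>x. [x]) ` X"
    by (auto simp: words_def length_Suc_conv)
  then show ?thesis by (simp add: sum.reindex inj_on_def)
qed

lemma sum_words_Suc:
  "(\<Sum>w\<in>words X (Suc n). f w) = (\<Sum>x\<in>X. \<Sum>w\<in>words X n. f (x # w))"
  using sum_words_append[where a = "Suc 0" and b = n and f = f and X = X] by (simp add: sum_words_1)

lemma sum_of_bool_le:
  assumes "finite S"
  shows "(\<Sum>x\<in>S. of_bool (P x)) \<le> real (card S)"
proof -
  have "(\<Sum>x\<in>S. of_bool (P x)) \<le> (\<Sum>x\<in>S. 1::real)" by (rule sum_mono) auto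
  then show ?thesis by simp
qed

lemma average_witness:
  fixes f :: "'a \<Rightarrow> real" and c :: real
  assumes "finite S" "S \<noteq> {}" "c * card S \<le> (\<Sum>x\<in>S. f x)"
  obtains x where "x \<in> S" "c \<le> f x"
proof -
  have "\<exists>x\<in>S. c \<le> f x"
  proof (rule ccontr)
    assume "\<not> (\<exists>x\<in>S. c \<le> f x)"
    then have "(\<Sum>x\<in>S. f x) < (\<Sum>x\<in>S. c)"
      by (intro sum_strict_mono) (use assms in \<open>auto simp: not_le\<close>)
    then show False using assms by (simp add: mult.commute)
  qed
  then show thesis using that by blast
qed

abbreviation cube :: "nat \<Rightarrow> nat \<Rightarrow> nat list set" where
  "cube k n \<equiv> words {..<k} n"

lemma card_cube: "card (cube k n) = k ^ n"
  by (simp add: card_words)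

text \<open>A real sum of indicators rather than a cardinality: exchanging the roles of prefix and
  suffix is then \<open>sum.swap\<close>, and weighted sums have the same form.\<close>

definition cnt :: "nat \<Rightarrow> nat \<Rightarrow> nat list set \<Rightarrow> real" where
  "cnt k n A = (\<Sum>w\<in>cube k n. of_bool (w \<in> A))"

lemma cnt_nonneg: "0 \<le> cnt k n A"
  unfolding cnt_def by (rule sum_nonneg) auto

lemma cnt_le: "cnt k n A \<le> real k ^ n"
  unfolding cnt_def using sum_of_bool_le[of "cube k n" "\<lambda>w. w \<in> A"] by (simp add: card_cube)

lemma cnt_append: "cnt k (a + b) A = (\<Sum>x\<in>cube k a. cnt k b {y. x @ y \<in> A})"
  unfolding cnt_def sum_words_append mem_Collect_eq ..

lemma cnt_append': "cnt k (a + b) A = (\<Sum>y\<in>cube k b. cnt k a {x. x @ y \<in> A})"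
  unfolding cnt_def sum_words_append mem_Collect_eq by (rule sum.swap)

lemma cube_nonempty: "0 < k \<Longrightarrow> cube k n \<noteq> {}"
  using card_cube[of k n] by (metis card.empty power_not_zero less_numeral_extra(3))

text \<open>
  An \<open>m\<close>-dimensional combinatorial subspace of \<open>[k]\<^sup>n\<close> is given by a template: a word whose
  entries are letters or one of the \<open>m\<close> variables, each of which occurs. Combinatorial lines are
  the case \<open>m = 1\<close>.
\<close>

datatype sym = Lit nat | Var nat

primrec sval :: "nat list \<Rightarrow> sym \<Rightarrow> nat" where
  "sval w (Lit c) = c"
| "sval w (Var j) = w ! j"

definition inst :: "sym list \<Rightarrow> nat list \<Rightarrow> nat list" where
  "inst t w = map (sval w) t"

definition tmpl :: "nat \<Rightarrow> nat \<Rightarrow> nat \<Rightarrow> sym list set" where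
  "tmpl k m n =
     {t. length t = n \<and> (\<forall>c. Lit c \<in> set t \<longrightarrow> c < k) \<and> (\<forall>j. Var j \<in> set t \<longleftrightarrow> j < m)}"

definition has_space :: "nat \<Rightarrow> nat \<Rightarrow> nat \<Rightarrow> nat list set \<Rightarrow> bool" where
  "has_space k m n A \<longleftrightarrow> (\<exists>t\<in>tmpl k m n. \<forall>w\<in>cube k m. inst t w \<in> A)"

text \<open>Substitution composes the two parametrisations (\<open>inst_subst\<close>), so a
  subspace of a subspace is again a subspace.\<close>

primrec subst_sym :: "sym list \<Rightarrow> sym \<Rightarrow> sym" where
  "subst_sym s (Lit c) = Lit c"
| "subst_sym s (Var j) = s ! j"

lemma finite_tmpl [simp]: "finite (tmpl k m n)"
proof -
  have "x \<in> Lit ` {..<k} \<union> Var ` {..<m}" if "t \<in> tmpl k m n" "x \<in> set t" for t x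
    using that by (cases x rule: sym.exhaust) (auto simp: tmpl_def)
  then have "tmpl k m n \<subseteq> words (Lit ` {..<k} \<union> Var ` {..<m}) n"
    unfolding words_def tmpl_def by blast
  then show ?thesis by (rule finite_subset) simp
qed

lemma tmpl_mono: "t \<in> tmpl k m n \<Longrightarrow> k \<le> k' \<Longrightarrow> t \<in> tmpl k' m n"
  unfolding tmpl_def using order.strict_trans2 by blast

lemma inst_append: "inst (s @ t) w = inst s w @ inst t w"
  by (simp add: inst_def)

lemma inst_Lit [simp]: "inst (map Lit x) w = x"
  by (simp add: inst_def comp_def)

lemma inst_cube:
  assumes "t \<in> tmpl k m n" "w \<in> cube k m"
  shows "inst t w \<in> cube k n"
proof -
  have "sval w x < k" if "x \<in> set t" for x
    using that assms(1) words_nth[OF assms(2)] by (cases x rule: sym.exhaust) (auto simp: tmpl_def)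
  then show ?thesis using assms(1) by (auto simp: inst_def words_def tmpl_def)
qed

text \<open>Every variable occurs in a template, so each parameter can be read off the instance at
  such a place.\<close>

lemma inst_inj:
  assumes "t \<in> tmpl k m n" "w \<in> words X m" "w' \<in> words X' m" "inst t w = inst t w'"
  shows "w = w'"
proof (rule nth_equalityI)
  show "length w = length w'" using assms by (simp add: words_length)
next
  fix j assume "j < length w"
  then have "Var j \<in> set t" using assms by (auto simp: tmpl_def words_length)
  then have "sval w (Var j) = sval w' (Var j)" using assms(4) by (auto simp: inst_def)
  then show "w ! j = w' ! j" by simp
qed

lemma inst_subst:
  assumes "t \<in> tmpl k m n" "length s = m"
  shows "inst (map (subst_sym s) t) w = inst t (inst s w)"
proof -
  have "sval w (subst_sym s x) = sval (map (sval w) s) x" if "x \<in> set t" for x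
    using that assms by (cases x rule: sym.exhaust) (auto simp: tmpl_def)
  then show ?thesis by (simp add: inst_def)
qed

lemma subst_tmpl:
  assumes "t \<in> tmpl k m n" "s \<in> tmpl k l m"
  shows "map (subst_sym s) t \<in> tmpl k l n"
proof -
  have len: "length s = m" using assms by (simp add: tmpl_def)
  have mem: "subst_sym s x \<in> set s" if "x = Var j" "x \<in> set t" for x j
    using that assms(1) len by (auto simp: tmpl_def)
  have 1: "c < k" if "x \<in> set t" "Lit c = subst_sym s x" for x c
  proof (cases x)
    case (Lit d)
    then show ?thesis using that assms(1) by (auto simp: tmpl_def)
  next
    case (Var j)
    then have "Lit c \<in> set s" using mem that by metis
    then show ?thesis using assms(2) by (auto simp: tmpl_def)
  qed
  have 2: "i < l" if "x \<in> set t" "Var i = subst_sym s x" for x i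
  proof (cases x)
    case (Lit d)
    then show ?thesis using that by simp
  next
    case (Var j)
    then have "Var i \<in> set s" using mem that by metis
    then show ?thesis using assms(2) by (auto simp: tmpl_def)
  qed
  have 3: "Var i \<in> subst_sym s ` set t" if "i < l" for i
  proof -
    have "Var i \<in> set s" using that assms(2) by (auto simp: tmpl_def)
    then obtain j where j: "j < m" "s ! j = Var i" using len by (auto simp: in_set_conv_nth)
    then have "Var j \<in> set t" using assms(1) by (auto simp: tmpl_def)
    then have "subst_sym s (Var j) \<in> subst_sym s ` set t" by (rule imageI)
    then show ?thesis using j(2) by simp
  qed
  have "length t = n" using assms(1) by (simp add: tmpl_def)
  then show ?thesis using 1 2 3 unfolding tmpl_def by (simp del: subst_sym.simps) blast
qed

lemma has_space_pullback:
  assumes "t \<in> tmpl k m n" "has_space k l m {w. inst t w \<in> A}"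
  shows "has_space k l n A"
proof -
  obtain s where s: "s \<in> tmpl k l m" "\<forall>w\<in>cube k l. inst t (inst s w) \<in> A"
    using assms(2) by (auto simp: has_space_def)
  have "length s = m" using s by (simp add: tmpl_def)
  then show ?thesis
    unfolding has_space_def
    using subst_tmpl[OF assms(1) s(1)] s(2) inst_subst[OF assms(1)] by metis
qed

lemma tmpl_Lit_append:
  assumes "t \<in> tmpl k m n" "x \<in> cube k a" "y \<in> cube k b"
  shows "map Lit x @ t @ map Lit y \<in> tmpl k m (a + (n + b))"
  using assms by (auto simp: tmpl_def words_def)

lemma has_space_slice:
  assumes "x \<in> cube k a" "y \<in> cube k b" "has_space k m n {v. x @ v @ y \<in> A}"
  shows "has_space k m (a + (n + b)) A"
proof -
  obtain t where t: "t \<in> tmpl k m n" "\<forall>w\<in>cube k m. x @ inst t w @ y \<in> A"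
    using assms(3) unfolding has_space_def by blast
  show ?thesis
    unfolding has_space_def
    by (rule bexI[OF _ tmpl_Lit_append[OF t(1) assms(1,2)]]) (use t(2) in \<open>simp add: inst_append\<close>)
qed

text \<open>Renumbering makes room for a line placed in front: \<open>Var 0\<close> belongs to the
  line, the later variables to the subspace behind it.\<close>

primrec shift_sym :: "sym \<Rightarrow> sym" where
  "shift_sym (Lit c) = Lit c"
| "shift_sym (Var j) = Var (Suc j)"

lemma tmpl_shift_append:
  assumes "t \<in> tmpl k 1 a" "s \<in> tmpl k m b"
  shows "t @ map shift_sym s \<in> tmpl k (Suc m) (a + b)"
proof -
  have 1: "Lit c \<in> shift_sym ` X \<longleftrightarrow> Lit c \<in> X" for c X
  proof
    show "Lit c \<in> X" if "Lit c \<in> shift_sym ` X"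
    proof -
      from that obtain x where "x \<in> X" "Lit c = shift_sym x" by blast
      then show ?thesis by (cases x) auto
    qed
  qed force
  have 2: "Var j \<in> shift_sym ` X \<longleftrightarrow> (\<exists>i. j = Suc i \<and> Var i \<in> X)" for j X
  proof
    show "\<exists>i. j = Suc i \<and> Var i \<in> X" if "Var j \<in> shift_sym ` X"
    proof -
      from that obtain x where "x \<in> X" "Var j = shift_sym x" by blast
      then show ?thesis by (cases x) auto
    qed
  qed force
  have "Var j \<in> set t \<or> (\<exists>i. j = Suc i \<and> Var i \<in> set s) \<longleftrightarrow> j < Suc m" for j
    using assms by (cases j) (auto simp: tmpl_def)
  then show ?thesis using assms by (auto simp: tmpl_def 1 2)
qed

lemma inst_shift_append:
  assumes "t \<in> tmpl k 1 a" "s \<in> tmpl k m b"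
  shows "inst (t @ map shift_sym s) (c # w) = inst t [c] @ inst s w"
proof -
  have "sval (c # w) x = sval [c] x" if "x \<in> set t" for x
    using that assms(1) by (cases x rule: sym.exhaust) (auto simp: tmpl_def)
  moreover have "sval (c # w) (shift_sym x) = sval w x" for x
    by (cases x) auto
  ultimately show ?thesis by (simp add: inst_def)
qed

subsection \<open>Sets insensitive to a pair of letters\<close>

text \<open>Only one dimension is claimed for each density; \<open>has_space_extend\<close> passes
  to all larger ones by averaging over suffixes.\<close>

definition dhj :: "nat \<Rightarrow> bool" where
  "dhj k \<longleftrightarrow> (\<forall>\<delta>>0. \<exists>n. \<forall>A. \<delta> * real k ^ n \<le> cnt k n A \<longrightarrow> has_space k 1 n A)"

text \<open>Points below the threshold \<open>a * B\<close> contribute at most \<open>a * B\<close>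
  each and the others at most \<open>B\<close>, so an average of \<open>(a + b) * B\<close> forces a
  proportion \<open>b\<close> to reach the threshold.\<close>

lemma markov:
  fixes f :: "'a \<Rightarrow> real"
  assumes "\<And>x. x \<in> S \<Longrightarrow> f x \<le> B" "0 < B" "0 \<le> a" "(a + b) * B * card S \<le> (\<Sum>x\<in>S. f x)"
  shows "b * card S \<le> (\<Sum>x\<in>S. of_bool (a * B \<le> f x))"
proof -
  have "(\<Sum>x\<in>S. f x) \<le> (\<Sum>x\<in>S. B * of_bool (a * B \<le> f x) + a * B)"
    using assms by (intro sum_mono) (auto simp: not_le intro: add_increasing2)
  also have "\<dots> = B * (\<Sum>x\<in>S. of_bool (a * B \<le> f x)) + a * B * card S"
    unfolding sum.distrib sum_distrib_left[symmetric] by simp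
  finally have "B * (b * card S) \<le> B * (\<Sum>x\<in>S. of_bool (a * B \<le> f x))"
    using assms(4) by (simp only: algebra_simps)
  then show ?thesis using assms(2) by (simp only: mult_le_cancel_left_pos)
qed

text \<open>Densely many suffixes \<open>y\<close> leave a section that contains a line. There are
  finitely many templates, so a single \<open>t\<close> serves a dense set of suffixes, and the
  induction hypothesis for this set supplies the other \<open>m\<close> variables.\<close>

lemma dhj_subspace:
  assumes "dhj k" "0 < k" "0 < \<delta>"
  shows "\<exists>n. \<forall>A. \<delta> * real k ^ n \<le> cnt k n A \<longrightarrow> has_space k m n A"
  using assms(3)
proof (induction m arbitrary: \<delta>)
  case 0
  have "has_space k 0 0 A" if "\<delta> * real k ^ 0 \<le> cnt k 0 A" for A
  proof -
    have "cnt k 0 A = of_bool ([] \<in> A)" by (simp add: cnt_def)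
    then have "[] \<in> A" using that 0 by (cases "[] \<in> A") auto
    moreover have "[] \<in> tmpl k 0 0" by (simp add: tmpl_def)
    ultimately show ?thesis unfolding has_space_def by (force simp: inst_def)
  qed
  then show ?case by blast
next
  case (Suc m)
  have "0 < \<delta> / 2" using Suc.prems by simp
  then obtain a where a: "\<And>A. \<delta> / 2 * real k ^ a \<le> cnt k a A \<Longrightarrow> has_space k 1 a A"
    using assms(1) unfolding dhj_def by meson
  define T where "T = tmpl k 1 a"
  \<comment> \<open>A proportion \<open>\<delta> / 2\<close> of the suffixes is shared among
    \<open>card T\<close> templates; the added 1 keeps the denominator positive before
    \<open>T\<close> is known to be nonempty.\<close>
  define d where "d = \<delta> / 2 / (real (card T) + 1)"
  have d: "0 < d" using Suc.prems by (simp add: d_def)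
  obtain b where b: "\<And>A. d * real k ^ b \<le> cnt k b A \<Longrightarrow> has_space k m b A"
    using Suc.IH[OF d] by blast
  have "has_space k (Suc m) (a + b) A" if A: "\<delta> * real k ^ (a + b) \<le> cnt k (a + b) A" for A
  proof -
    let ?f = "\<lambda>y. cnt k a {x. x @ y \<in> A}"
    let ?B = "\<lambda>t. {y. \<forall>w\<in>cube k 1. inst t w @ y \<in> A}"
    have "\<delta> / 2 * card (cube k b) \<le> (\<Sum>y\<in>cube k b. of_bool (\<delta> / 2 * real k ^ a \<le> ?f y))"
    proof (rule markov)
      show "(\<delta> / 2 + \<delta> / 2) * real k ^ a * card (cube k b) \<le> (\<Sum>y\<in>cube k b. ?f y)"
        using A unfolding cnt_append' by (simp add: card_cube power_add)
    qed (use assms Suc.prems cnt_le in auto)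
    also have "\<dots> \<le> (\<Sum>y\<in>cube k b. \<Sum>t\<in>T. of_bool (y \<in> ?B t))"
    proof (rule sum_mono)
      fix y
      show "of_bool (\<delta> / 2 * real k ^ a \<le> ?f y) \<le> (\<Sum>t\<in>T. of_bool (y \<in> ?B t) :: real)"
      proof (cases "\<delta> / 2 * real k ^ a \<le> ?f y")
        case True
        then obtain t where t: "t \<in> T" "y \<in> ?B t"
          using a unfolding has_space_def T_def by blast
        then have "of_bool (y \<in> ?B t) \<le> (\<Sum>t\<in>T. of_bool (y \<in> ?B t) :: real)"
          by (intro member_le_sum) (auto simp: T_def)
        then show ?thesis using True t(2) by (simp only: of_bool_eq)
      next
        case False
        then show ?thesis by (simp only: of_bool_eq) (intro sum_nonneg, simp)
      qed
    qed
    also have "\<dots> = (\<Sum>t\<in>T. cnt k b (?B t))" unfolding cnt_def by (rule sum.swap)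
    finally have le: "\<delta> / 2 * real k ^ b \<le> (\<Sum>t\<in>T. cnt k b (?B t))" by (simp add: card_cube)
    have pos: "0 < \<delta> / 2 * real k ^ b" using Suc.prems assms(2) by simp
    have "T \<noteq> {}" using le pos by force
    moreover have "d * real k ^ b * card T \<le> \<delta> / 2 * real k ^ b"
    proof -
      have "d * card T \<le> \<delta> / 2" using Suc.prems by (simp add: d_def field_simps)
      then have "(d * card T) * real k ^ b \<le> \<delta> / 2 * real k ^ b" by (rule mult_right_mono) simp
      then show ?thesis by (simp add: ac_simps)
    qed
    ultimately obtain t where t: "t \<in> T" "d * real k ^ b \<le> cnt k b (?B t)"
      using average_witness[of T "d * real k ^ b" "\<lambda>t. cnt k b (?B t)"] le
      by (auto simp: T_def)
    then obtain s where s: "s \<in> tmpl k m b" "\<forall>w\<in>cube k m. inst s w \<in> ?B t"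
      using b unfolding has_space_def by blast
    have t1: "t \<in> tmpl k 1 a" using t(1) by (simp add: T_def)
    have "inst (t @ map shift_sym s) w \<in> A" if "w \<in> cube k (Suc m)" for w
    proof -
      obtain c v where cv: "w = c # v" "[c] \<in> cube k 1" "v \<in> cube k m"
        using \<open>w \<in> cube k (Suc m)\<close> by (cases w) (auto simp: words_def)
      have "inst t [c] @ inst s v \<in> A" using s(2) cv(2,3) by blast
      then show ?thesis using cv(1) inst_shift_append[OF t1 s(1)] by metis
    qed
    then show ?thesis
      unfolding has_space_def using tmpl_shift_append[OF t1 s(1)] by blast
  qed
  then show ?case by blast
qed

text \<open>
  In a long block over \<open>[k+1]\<close> all but few words contain a letter below \<open>k\<close>; freeing the first such
  letter splits them into lines over \<open>[k]\<close>.
\<close>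
lemma free_one_letter:
  fixes g :: "nat list \<Rightarrow> real"
  assumes k: "0 < k" and g: "\<And>w. 0 \<le> g w" "\<And>w. g w \<le> 1"
  shows "\<exists>u\<in>tmpl (Suc k) 1 (Suc s). (\<Sum>w\<in>cube (Suc k) (Suc s). g w) / real (Suc k) ^ Suc s
     \<le> (\<Sum>c<k. g (inst u [c])) / k + 1 / real (Suc k) ^ Suc s"
  using g
proof (induction s arbitrary: g)
  case 0
  have 1: "[Var 0] \<in> tmpl (Suc k) 1 (Suc 0)" by (auto simp: tmpl_def)
  have "(\<Sum>w\<in>cube (Suc k) (Suc 0). g w) = (\<Sum>c<k. g [c]) + g [k]"
    by (simp add: sum_words_1)
  also have "\<dots> \<le> (\<Sum>c<k. g [c]) + 1" using 0 by simp
  finally have "(\<Sum>w\<in>cube (Suc k) (Suc 0). g w) / Suc k \<le> ((\<Sum>c<k. g [c]) + 1) / Suc k"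
    by (rule divide_right_mono) simp
  also have "\<dots> = (\<Sum>c<k. g [c]) / Suc k + 1 / Suc k" by (simp only: add_divide_distrib)
  also have "(\<Sum>c<k. g [c]) / Suc k \<le> (\<Sum>c<k. g [c]) / k"
    using k 0 by (intro divide_left_mono sum_nonneg) auto
  finally show ?case
    by (intro bexI[OF _ 1]) (simp add: inst_def)
next
  case (Suc s)
  let ?K = "real (Suc k)"
  let ?C = "cube (Suc k) (Suc s)"
  \<comment> \<open>Words are split by their first letter. If it is \<open>k\<close>, it stays fixed
    and the induction hypothesis frees a later letter; otherwise it is itself freed, in front of the
    best continuation \<open>v\<close>.\<close>
  define P where "P = (\<Sum>w\<in>?C. g (k # w)) / ?K ^ Suc s"
  define Q where "Q = (\<Sum>w\<in>?C. \<Sum>c<k. g (c # w))"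
  define e where "e = 1 / ?K ^ Suc s"
  obtain u where u: "u \<in> tmpl (Suc k) 1 (Suc s)" "P \<le> (\<Sum>c<k. g (k # inst u [c])) / k + e"
    using Suc.IH[of "\<lambda>w. g (k # w)"] Suc.prems unfolding P_def e_def by blast
  have "Q / ?K ^ Suc s * real (card ?C) \<le> (\<Sum>w\<in>?C. \<Sum>c<k. g (c # w))"
    unfolding Q_def card_cube of_nat_power by (simp del: of_nat_Suc power_Suc)
  then obtain v where v: "v \<in> ?C" "Q / ?K ^ Suc s \<le> (\<Sum>c<k. g (c # v))"
    by (rule average_witness[rotated 2]) (auto simp: cube_nonempty)
  have tot: "(\<Sum>w\<in>cube (Suc k) (Suc (Suc s)). g w) = Q + ?K ^ Suc s * P"
  proof -
    have "(\<Sum>w\<in>cube (Suc k) (Suc (Suc s)). g w) = (\<Sum>c<Suc k. \<Sum>w\<in>?C. g (c # w))"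
      by (rule sum_words_Suc)
    also have "\<dots> = (\<Sum>c<k. \<Sum>w\<in>?C. g (c # w)) + (\<Sum>w\<in>?C. g (k # w))"
      by (simp only: sum.lessThan_Suc)
    also have "(\<Sum>c<k. \<Sum>w\<in>?C. g (c # w)) = Q" unfolding Q_def by (rule sum.swap)
    finally show ?thesis unfolding P_def by simp
  qed
  define q where "q = (\<Sum>c<k. g (c # v)) / k"
  define p where "p = (\<Sum>c<k. g (k # inst u [c])) / k"
  have "Q + ?K ^ Suc s * P \<le> ?K ^ Suc s * (k * q) + ?K ^ Suc s * (p + e)"
  proof (rule add_mono)
    have "Q \<le> (\<Sum>c<k. g (c # v)) * ?K ^ Suc s" using v(2) by (subst (asm) pos_divide_le_eq) simp_all
    then show "Q \<le> ?K ^ Suc s * (k * q)" unfolding q_def using k by (simp add: mult.commute)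
    show "?K ^ Suc s * P \<le> ?K ^ Suc s * (p + e)"
      using u(2) unfolding p_def by (intro mult_left_mono) auto
  qed
  also have "\<dots> = ?K ^ Suc s * (k * q + p + e)" by (simp only: algebra_simps)
  finally have "(Q + ?K ^ Suc s * P) / ?K ^ Suc (Suc s) \<le> ?K ^ Suc s * (k * q + p + e) / ?K ^ Suc (Suc s)"
    by (rule divide_right_mono) simp
  also have "\<dots> = (k * q + p + e) / ?K"
    unfolding power_Suc[of ?K "Suc s"] by (simp del: of_nat_Suc power_Suc)
  finally have *: "(Q + ?K ^ Suc s * P) / ?K ^ Suc (Suc s) \<le> (k * q + p + e) / ?K" .
  \<comment> \<open>The average is at most a convex combination of \<open>q\<close> (weight
    \<open>k / Suc k\<close>) and \<open>p + e\<close> (weight \<open>1 / Suc k\<close>), so the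
    better of the two candidates suffices, and the inherited error \<open>e\<close> shrinks by the
    factor \<open>Suc k\<close>.\<close>
  have **: "(k * q + p + e) / ?K \<le> max p q + e / ?K"
  proof -
    have "k * q + p \<le> k * max p q + max p q" by (intro add_mono mult_left_mono) auto
    then have "k * q + p + e \<le> ?K * max p q + e" by (simp add: algebra_simps)
    then have "(k * q + p + e) / ?K \<le> (?K * max p q + e) / ?K" by (rule divide_right_mono) simp
    also have "\<dots> = max p q + e / ?K" by (simp add: add_divide_distrib del: of_nat_Suc)
    finally show ?thesis .
  qed
  have 1: "Lit k # u \<in> tmpl (Suc k) 1 (Suc (Suc s))" using u(1) by (auto simp: tmpl_def)
  have 2: "Var 0 # map Lit v \<in> tmpl (Suc k) 1 (Suc (Suc s))"
    using v(1) by (auto simp: tmpl_def words_def)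
  have main: "(\<Sum>w\<in>cube (Suc k) (Suc (Suc s)). g w) / ?K ^ Suc (Suc s)
      \<le> max p q + 1 / ?K ^ Suc (Suc s)"
  proof -
    have "e / ?K = 1 / ?K ^ Suc (Suc s)"
      unfolding e_def power_Suc[of ?K "Suc s"] by (simp del: of_nat_Suc power_Suc)
    then show ?thesis using * ** unfolding tot by linarith
  qed
  show ?case
  proof (cases "p \<le> q")
    case True
    then show ?thesis using main by (intro bexI[OF _ 2]) (simp add: q_def inst_def comp_def)
  next
    case False
    then show ?thesis using main by (intro bexI[OF _ 1]) (simp add: p_def inst_def)
  qed
qed

text \<open>For the indicator of a dense set this yields a subspace whose points with parameters
  below \<open>k\<close> still meet the set densely. Variables are freed one block at a time; the
  words lost in the first block cost at most \<open>\<eta> / 2\<close>, and the other half is left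
  to the induction.\<close>

lemma free_letters:
  assumes k: "0 < k" and "0 < \<eta>"
  shows "\<exists>M. \<forall>g :: nat list \<Rightarrow> real. (\<forall>w. 0 \<le> g w \<and> g w \<le> 1) \<longrightarrow>
    (\<exists>t\<in>tmpl (Suc k) m M. (\<Sum>w\<in>cube (Suc k) M. g w) / real (Suc k) ^ M
       \<le> (\<Sum>x\<in>cube k m. g (inst t x)) / real k ^ m + \<eta>)"
  using assms(2)
proof (induction m arbitrary: \<eta>)
  case 0
  have "[] \<in> tmpl (Suc k) 0 0" by (simp add: tmpl_def)
  then show ?case using 0 by (intro exI[of _ 0] allI impI bexI[of _ "[]"]) (auto simp: inst_def)
next
  case (Suc m)
  let ?K = "real (Suc k)"
  obtain s where "(1 / ?K) ^ s < \<eta> / 2"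
    using real_arch_pow_inv[of "\<eta> / 2" "1 / ?K"] Suc.prems k by (auto simp del: of_nat_Suc)
  moreover have "(1 / ?K) ^ Suc s \<le> (1 / ?K) ^ s" by (rule power_decreasing) auto
  ultimately have s: "1 / ?K ^ Suc s \<le> \<eta> / 2" unfolding power_one_over by linarith
  have "0 < \<eta> / 2" using Suc.prems by simp
  from Suc.IH[OF this] obtain M where M: "\<And>g :: nat list \<Rightarrow> real. \<lbrakk>\<And>w. 0 \<le> g w; \<And>w. g w \<le> 1\<rbrakk> \<Longrightarrow>
    (\<exists>t\<in>tmpl (Suc k) m M. (\<Sum>w\<in>cube (Suc k) M. g w) / ?K ^ M
       \<le> (\<Sum>x\<in>cube k m. g (inst t x)) / real k ^ m + \<eta> / 2)"
    by meson
  have "\<exists>t\<in>tmpl (Suc k) (Suc m) (Suc s + M). (\<Sum>w\<in>cube (Suc k) (Suc s + M). g w) / ?K ^ (Suc s + M)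
       \<le> (\<Sum>x\<in>cube k (Suc m). g (inst t x)) / real k ^ Suc m + \<eta>"
    if g: "\<And>w. 0 \<le> g w" "\<And>w. g w \<le> 1" for g :: "nat list \<Rightarrow> real"
  proof -
    define h where "h v = (\<Sum>y\<in>cube (Suc k) M. g (v @ y)) / ?K ^ M" for v
    have "h v \<le> 1" for v
    proof -
      have "(\<Sum>y\<in>cube (Suc k) M. g (v @ y)) \<le> of_nat (card (cube (Suc k) M)) * 1"
        by (rule sum_bounded_above) (rule g)
      then show ?thesis by (simp add: h_def card_cube)
    qed
    moreover have "0 \<le> h v" for v unfolding h_def by (intro divide_nonneg_nonneg sum_nonneg g) auto
    ultimately obtain u where u: "u \<in> tmpl (Suc k) 1 (Suc s)"
      "(\<Sum>v\<in>cube (Suc k) (Suc s). h v) / ?K ^ Suc s \<le> (\<Sum>c<k. h (inst u [c])) / k + 1 / ?K ^ Suc s"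
      using free_one_letter[OF k, of h s] by blast
    \<comment> \<open>\<open>g'\<close> averages \<open>g\<close> over the line freed in the first
      block. It again has values between 0 and 1, so the induction hypothesis applies to it on the
      remaining \<open>M\<close> letters.\<close>
    define g' where "g' y = (\<Sum>c<k. g (inst u [c] @ y)) / k" for y
    have "g' y \<le> 1" for y
    proof -
      have "(\<Sum>c<k. g (inst u [c] @ y)) \<le> of_nat (card {..<k}) * 1"
        by (rule sum_bounded_above) (rule g)
      then show ?thesis using k by (simp add: g'_def)
    qed
    moreover have "0 \<le> g' y" for y unfolding g'_def by (intro divide_nonneg_nonneg sum_nonneg g) auto
    ultimately obtain t where t: "t \<in> tmpl (Suc k) m M"
      "(\<Sum>y\<in>cube (Suc k) M. g' y) / ?K ^ M \<le> (\<Sum>x\<in>cube k m. g' (inst t x)) / real k ^ m + \<eta> / 2"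
      using M[of g'] by blast
    have "(\<Sum>w\<in>cube (Suc k) (Suc s + M). g w) / ?K ^ (Suc s + M)
        = (\<Sum>v\<in>cube (Suc k) (Suc s). h v) / ?K ^ Suc s"
      unfolding sum_words_append h_def sum_divide_distrib[symmetric] power_add by (simp only: divide_divide_eq_left mult.commute)
    also have "\<dots> \<le> (\<Sum>c<k. h (inst u [c])) / k + \<eta> / 2" using u(2) s by linarith
    also have "(\<Sum>c<k. h (inst u [c])) / k = (\<Sum>y\<in>cube (Suc k) M. g' y) / ?K ^ M"
      unfolding h_def g'_def sum_divide_distrib[symmetric] sum.swap[of _ "cube (Suc k) M"]
      by (simp only: divide_divide_eq_left mult.commute)
    also have "\<dots> + \<eta> / 2 \<le> (\<Sum>x\<in>cube k m. g' (inst t x)) / real k ^ m + \<eta>" using t(2) by linarith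
    also have "(\<Sum>x\<in>cube k m. g' (inst t x)) / real k ^ m
        = (\<Sum>x\<in>cube k (Suc m). g (inst (u @ map shift_sym t) x)) / real k ^ Suc m"
      unfolding sum_words_Suc inst_shift_append[OF u(1) t(1)] g'_def sum_divide_distrib[symmetric]
        sum.swap[of _ "{..<k}"]
      by (simp add: divide_divide_eq_left)
    finally show ?thesis using tmpl_shift_append[OF u(1) t(1)] by blast
  qed
  then show ?case by blast
qed

section \<open>Insensitive sets: subspaces inside them and tilings by subspaces\<close>

abbreviation lower :: "nat \<Rightarrow> nat \<Rightarrow> nat list \<Rightarrow> nat list" where
  "lower k i w \<equiv> map (\<lambda>a. if a = k then i else a) w"

definition insens :: "nat \<Rightarrow> nat \<Rightarrow> nat \<Rightarrow> nat list set \<Rightarrow> bool" where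
  "insens k i n D \<longleftrightarrow> (\<forall>w\<in>cube (Suc k) n. \<forall>w'\<in>cube (Suc k) n.
     lower k i w = lower k i w' \<longrightarrow> (w \<in> D \<longleftrightarrow> w' \<in> D))"

lemma lower_inst:
  assumes "t \<in> tmpl q m n" "length w = m" "length w' = m" "lower k i w = lower k i w'"
  shows "lower k i (inst t w) = lower k i (inst t w')"
proof -
  have *: "(if w ! j = k then i else w ! j) = (if w' ! j = k then i else w' ! j)" if "j < m" for j
    using arg_cong[OF assms(4), of "\<lambda>v. v ! j"] that assms(2,3) by simp
  then have "(if sval w x = k then i else sval w x) = (if sval w' x = k then i else sval w' x)"
    if "x \<in> set t" for x
  proof (cases x)
    case (Var j)
    then have "j < m" using that assms(1) by (auto simp: tmpl_def)
    then show ?thesis unfolding Var sval.simps by (rule *)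
  qed simp
  then show ?thesis by (simp add: inst_def)
qed

lemma insens_pullback:
  assumes "insens k i n D" "t \<in> tmpl (Suc k) m n"
  shows "insens k i m {w. inst t w \<in> D}"
  unfolding insens_def mem_Collect_eq
  using assms inst_cube[OF assms(2)] lower_inst[OF assms(2)] words_length
  unfolding insens_def by meson

text \<open>\<open>free_letters\<close> makes \<open>D\<close> dense on the points of a subspace
  with parameters below \<open>k\<close>, the theorem over \<open>[k]\<close> finds a smaller
  subspace there, and insensitivity admits the parameter \<open>k\<close> as well, because replacing
  it by \<open>i < k\<close> does not change membership.\<close>

lemma insens_has_space:
  assumes "dhj k" "0 < k" "0 < \<beta>"
  shows "\<exists>M. \<forall>i<k. \<forall>D. insens k i M D \<longrightarrow> \<beta> * real (Suc k) ^ M \<le> cnt (Suc k) M D \<longrightarrow>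
    has_space (Suc k) m M D"
proof -
  have b2: "0 < \<beta> / 2" using assms(3) by simp
  obtain m' where m': "\<And>A. \<beta> / 2 * real k ^ m' \<le> cnt k m' A \<Longrightarrow> has_space k m m' A"
    using dhj_subspace[OF assms(1,2) b2] by meson
  obtain M where M: "\<And>g :: nat list \<Rightarrow> real. \<lbrakk>\<And>w. 0 \<le> g w; \<And>w. g w \<le> 1\<rbrakk> \<Longrightarrow>
    (\<exists>t\<in>tmpl (Suc k) m' M. (\<Sum>w\<in>cube (Suc k) M. g w) / real (Suc k) ^ M
       \<le> (\<Sum>x\<in>cube k m'. g (inst t x)) / real k ^ m' + \<beta> / 2)"
    using free_letters[OF assms(2) b2, of m'] by meson
  have "has_space (Suc k) m M D"
    if i: "i < k" and D: "insens k i M D" "\<beta> * real (Suc k) ^ M \<le> cnt (Suc k) M D" for i D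
  proof -
    obtain t where t: "t \<in> tmpl (Suc k) m' M" "cnt (Suc k) M D / real (Suc k) ^ M
       \<le> cnt k m' {x. inst t x \<in> D} / real k ^ m' + \<beta> / 2"
      using M[of "\<lambda>w. of_bool (w \<in> D)"] unfolding cnt_def by auto
    have "\<beta> \<le> cnt (Suc k) M D / real (Suc k) ^ M"
      by (subst pos_le_divide_eq) (use D(2) in simp_all)
    then have "\<beta> / 2 \<le> cnt k m' {x. inst t x \<in> D} / real k ^ m'" using t(2) by linarith
    then have "\<beta> / 2 * real k ^ m' \<le> cnt k m' {x. inst t x \<in> D}"
      by (subst (asm) pos_le_divide_eq) (use assms(2) in simp_all)
    then obtain s where s: "s \<in> tmpl k m m'" "\<forall>w\<in>cube k m. inst t (inst s w) \<in> D"
      using m' unfolding has_space_def by blast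
    have s': "s \<in> tmpl (Suc k) m m'" using s(1) by (rule tmpl_mono) simp
    have "insens k i m {w. inst t (inst s w) \<in> D}"
      using insens_pullback[OF insens_pullback[OF D(1) t(1)] s'] by simp
    then have *: "inst t (inst s w) \<in> D" if "w \<in> cube (Suc k) m" for w
    proof -
      assume ins: "insens k i m {w. inst t (inst s w) \<in> D}"
      have low: "lower k i w \<in> cube k m" using that i by (auto simp: words_def)
      then have "inst t (inst s (lower k i w)) \<in> D" using s(2) by blast
      moreover have "lower k i w \<in> cube (Suc k) m" using low by (auto simp: words_def)
      moreover have "lower k i (lower k i w) = lower k i w" using i by simp
      ultimately show ?thesis using ins that unfolding insens_def by blast
    qed
    have "length s = m'" using s(1) by (simp add: tmpl_def)
    then show ?thesis
      unfolding has_space_def using subst_tmpl[OF t(1) s'] * inst_subst[OF t(1)] by metis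
  qed
  then show ?thesis by blast
qed

text \<open>
  Greedy tiling: read a block of \<open>M\<close> letters; wherever the section of \<open>D\<close> in that block is dense it
  contains a subspace, and removing these subspaces keeps \<open>D\<close> insensitive in the letters not yet
  read. Each block removes a fixed proportion of the cube until less than \<open>\<beta>\<close> of it is left.
\<close>
lemma sum_insens_aux:
  fixes g :: "nat list \<Rightarrow> real"
  assumes K_def: "K = Suc k" and M: "\<And>D. insens k i M D \<Longrightarrow> \<beta> / 2 * real K ^ M \<le> cnt K M D \<Longrightarrow> has_space K m M D"
    and "0 < \<beta>" and g: "\<And>w. g w \<le> 1" and "0 \<le> \<sigma>"
  shows "(\<And>x. x \<in> cube K a \<Longrightarrow> insens k i (t * M + r) {y. x @ y \<in> D}) \<Longrightarrow>
    (\<And>u. u \<in> tmpl K m (a + (t * M + r)) \<Longrightarrow> (\<Sum>w\<in>cube K m. g (inst u w)) \<le> \<sigma> * real K ^ m) \<Longrightarrow>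
    (\<Sum>w\<in>cube K (a + (t * M + r)). of_bool (w \<in> D) * g w) \<le> \<sigma> * cnt K (a + (t * M + r)) D +
      max (\<beta> * real K ^ (a + (t * M + r)))
        (cnt K (a + (t * M + r)) D - t * (\<beta> / 2 * real K ^ m / real K ^ M) * real K ^ (a + (t * M + r)))"
\<comment> \<open>\<open>a\<close> letters have been read, \<open>t\<close> blocks of length
  \<open>M\<close> are still to come, and \<open>r\<close> letters stay unread. The maximum bounds
  what the remaining blocks leave of \<open>D\<close>: either a proportion below
  \<open>\<beta>\<close>, or \<open>D\<close> diminished by one share per block.\<close>
proof (induction t arbitrary: a D)
  case 0
  have "(\<Sum>w\<in>cube K (a + (0 * M + r)). of_bool (w \<in> D) * g w) \<le> cnt K (a + (0 * M + r)) D"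
    unfolding cnt_def by (rule sum_mono) (simp add: g)
  moreover have "0 \<le> \<sigma> * cnt K (a + (0 * M + r)) D" by (intro mult_nonneg_nonneg \<open>0 \<le> \<sigma>\<close> cnt_nonneg)
  ultimately show ?case by (simp add: max_def)
next
  case (Suc t)
  define q where "q = t * M + r"
  define n where "n = a + (M + q)"
  have eq: "a + (Suc t * M + r) = n" by (simp add: n_def q_def)
  \<comment> \<open>At least a proportion \<open>\<beta> / 2\<close> of the pairs of prefix and
    suffix have a dense section, and each of these sections loses a subspace, that is,
    \<open>K ^ m\<close> of the \<open>K ^ M\<close> words of the block.\<close>
  let ?\<gamma> = "\<beta> / 2 * real K ^ m / real K ^ M"
  have K: "0 < real K" by (simp add: K_def)
  have le_cnt: "(\<Sum>w\<in>cube K n. of_bool (w \<in> D) * g w) \<le> cnt K n D"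
    unfolding cnt_def by (rule sum_mono) (simp add: g)
  show ?case
  proof (cases "cnt K n D \<le> \<beta> * real K ^ n")
    case True
    have "0 \<le> \<sigma> * cnt K n D" by (intro mult_nonneg_nonneg \<open>0 \<le> \<sigma>\<close> cnt_nonneg)
    then show ?thesis using True le_cnt unfolding eq by linarith
  next
    case large: False
    define E where "E x y = {v \<in> cube K M. x @ v @ y \<in> D}" for x y
    define good where "good x y \<longleftrightarrow> \<beta> / 2 * real K ^ M \<le> cnt K M (E x y)" for x y
    \<comment> \<open>The template is chosen as a function of the section alone. Suffixes that
      \<open>D\<close> does not distinguish have equal sections, hence lose the same subspace; this
      is what keeps \<open>D - R\<close> insensitive in the unread letters.\<close>
    define \<tau> where "\<tau> S = (SOME u. u \<in> tmpl K m M \<and> (\<forall>w\<in>cube K m. inst u w \<in> S))" for S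
    define V where "V x y = (if good x y then inst (\<tau> (E x y)) ` cube K m else {})" for x y
    define R where "R = {w. take M (drop a w) \<in> V (take a w) (drop (a + M) w)}"
    have R: "x @ v @ y \<in> R \<longleftrightarrow> v \<in> V x y" if "x \<in> cube K a" "v \<in> cube K M" for x v y
      using that by (simp add: R_def words_length)
    have insD: "x @ v @ y \<in> D \<longleftrightarrow> x @ v' @ y' \<in> D"
      if "x \<in> cube K a" "v @ y \<in> cube K (M + q)" "v' @ y' \<in> cube K (M + q)"
        "lower k i (v @ y) = lower k i (v' @ y')" for x v v' y y'
    proof -
      have "insens k i (M + q) {y. x @ y \<in> D}" using Suc.prems(1)[OF that(1)] by (simp add: q_def add.assoc)
      from this[unfolded insens_def, rule_format, of "v @ y" "v' @ y'"] show ?thesis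
        using that unfolding K_def by simp
    qed
    have insE: "insens k i M (E x y)" if "x \<in> cube K a" "y \<in> cube K q" for x y
      unfolding insens_def
    proof (intro ballI impI)
      fix v v' assume v: "v \<in> cube (Suc k) M" "v' \<in> cube (Suc k) M" "lower k i v = lower k i v'"
      then have "v @ y \<in> cube K (M + q)" "v' @ y \<in> cube K (M + q)"
        using that by (auto simp: K_def intro: words_append)
      then show "v \<in> E x y \<longleftrightarrow> v' \<in> E x y"
        using insD[OF that(1), of v y v' y] v by (simp add: E_def K_def)
    qed
    have \<tau>: "\<tau> (E x y) \<in> tmpl K m M" "\<forall>w\<in>cube K m. inst (\<tau> (E x y)) w \<in> E x y"
      if "x \<in> cube K a" "y \<in> cube K q" "good x y" for x y
    proof -
      have "has_space K m M (E x y)" using M insE that unfolding good_def by blast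
      then have "\<exists>u. u \<in> tmpl K m M \<and> (\<forall>w\<in>cube K m. inst u w \<in> E x y)"
        unfolding has_space_def by blast
      from someI_ex[OF this] show "\<tau> (E x y) \<in> tmpl K m M" "\<forall>w\<in>cube K m. inst (\<tau> (E x y)) w \<in> E x y"
        unfolding \<tau>_def by auto
    qed
    have VE: "V x y \<subseteq> E x y" if "x \<in> cube K a" "y \<in> cube K q" for x y
      using \<tau>[OF that] by (auto simp: V_def)
    have split3: "(\<Sum>w\<in>cube K n. h w) = (\<Sum>x\<in>cube K a. \<Sum>y\<in>cube K q. \<Sum>v\<in>cube K M. h (x @ v @ y))"
      for h :: "nat list \<Rightarrow> real"
      unfolding n_def sum_words_append by (rule sum.cong[OF refl]) (rule sum.swap)
    have RD: "w \<in> D" if "w \<in> R" "w \<in> cube K n" for w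
    proof -
      have cube: "take a w \<in> cube K a" "drop (a + M) w \<in> cube K q"
        using that(2) by (auto simp: words_def n_def dest!: in_set_takeD in_set_dropD)
      have w: "take a w @ take M (drop a w) @ drop (a + M) w = w"
        by (metis add.commute append_take_drop_id drop_drop)
      have "take M (drop a w) \<in> V (take a w) (drop (a + M) w)" using that(1) by (simp add: R_def)
      then have "take M (drop a w) \<in> E (take a w) (drop (a + M) w)" using VE[OF cube] by (rule rev_subsetD)
      then show ?thesis unfolding E_def mem_Collect_eq w by simp
    qed
    define N where "N = (\<Sum>x\<in>cube K a. \<Sum>y\<in>cube K q. of_bool (good x y) :: real)"
    have sumV: "(\<Sum>v\<in>cube K M. of_bool (x @ v @ y \<in> R) * h (x @ v @ y))
        = (\<Sum>w\<in>cube K m. h (inst (map Lit x @ \<tau> (E x y) @ map Lit y) w))"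
      if xy: "x \<in> cube K a" "y \<in> cube K q" "good x y" for x y and h :: "nat list \<Rightarrow> real"
    proof -
      have "(\<Sum>v\<in>cube K M. of_bool (x @ v @ y \<in> R) * h (x @ v @ y))
          = (\<Sum>v\<in>cube K M. of_bool (v \<in> V x y) * h (x @ v @ y))"
        using R xy by (intro sum.cong) auto
      also have "\<dots> = (\<Sum>v\<in>V x y. h (x @ v @ y))"
        using VE[OF xy(1,2)] unfolding E_def
        by (intro sum.mono_neutral_cong_right) auto
      also have "\<dots> = (\<Sum>w\<in>cube K m. h (x @ inst (\<tau> (E x y)) w @ y))"
        unfolding V_def using xy(3) inst_inj[OF \<tau>(1)[OF xy]]
        by (simp add: inj_on_def sum.reindex)
      finally show ?thesis by (simp add: inst_append)
    qed
    have notgood: "(\<Sum>v\<in>cube K M. of_bool (x @ v @ y \<in> R) * h (x @ v @ y)) = 0"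
      if "x \<in> cube K a" "\<not> good x y" for x y and h :: "nat list \<Rightarrow> real"
      using that R[OF that(1)] by (intro sum.neutral) (auto simp: V_def)
    have "(\<Sum>v\<in>cube K M. of_bool (x @ v @ y \<in> R) * g (x @ v @ y)) \<le> \<sigma> * real K ^ m * of_bool (good x y)"
      if xy: "x \<in> cube K a" "y \<in> cube K q" for x y
    proof (cases "good x y")
      case True
      have "map Lit x @ \<tau> (E x y) @ map Lit y \<in> tmpl K m (a + (Suc t * M + r))"
        unfolding eq n_def by (rule tmpl_Lit_append[OF \<tau>(1)[OF xy True] xy])
      from Suc.prems(2)[OF this] show ?thesis using sumV[OF xy True] True by simp
    next
      case False
      then show ?thesis using notgood[OF xy(1) False] by simp
    qed
    then have sumR: "(\<Sum>w\<in>cube K n. of_bool (w \<in> R) * g w) \<le> \<sigma> * (real K ^ m * N)"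
      unfolding split3 N_def sum_distrib_left mult.assoc[symmetric] by (intro sum_mono)
    have "(\<Sum>v\<in>cube K M. of_bool (x @ v @ y \<in> R) * 1) = real K ^ m * of_bool (good x y)"
      if xy: "x \<in> cube K a" "y \<in> cube K q" for x y
      using sumV[OF xy, of "\<lambda>_. 1"] notgood[OF xy(1), of y "\<lambda>_. 1"]
      by (cases "good x y") (simp_all add: card_cube)
    then have cntR: "cnt K n R = real K ^ m * N"
      unfolding cnt_def split3 N_def sum_distrib_left by (intro sum.cong refl) simp
    have "(\<Sum>v\<in>cube K M. of_bool (x @ v @ y \<in> D)) \<le> real K ^ M * of_bool (good x y) + \<beta> / 2 * real K ^ M"
      if xy: "x \<in> cube K a" "y \<in> cube K q" for x y
    proof -
      have *: "(\<Sum>v\<in>cube K M. of_bool (x @ v @ y \<in> D)) = cnt K M (E x y)"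
        unfolding cnt_def E_def by (intro sum.cong) auto
      have "0 \<le> \<beta> / 2 * real K ^ M" using \<open>0 < \<beta>\<close> by simp
      then show ?thesis using cnt_le[of K M "E x y"] unfolding *
        by (cases "good x y") (auto simp: good_def)
    qed
    then have "cnt K n D \<le> (\<Sum>x\<in>cube K a. \<Sum>y\<in>cube K q. real K ^ M * of_bool (good x y) + \<beta> / 2 * real K ^ M)"
      unfolding cnt_def split3 by (intro sum_mono)
    also have "\<dots> = real K ^ M * N + \<beta> / 2 * real K ^ n"
      unfolding sum.distrib N_def sum_distrib_left[symmetric]
      by (simp add: card_cube n_def power_add)
    finally have "\<beta> / 2 * real K ^ n \<le> real K ^ M * N" using large by linarith
    then have "\<beta> / 2 * real K ^ n / real K ^ M \<le> N"
      by (subst pos_divide_le_eq) (use K in \<open>simp_all add: mult.commute\<close>)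
    then have "real K ^ m * (\<beta> / 2 * real K ^ n / real K ^ M) \<le> real K ^ m * N"
      by (rule mult_left_mono) simp
    then have Rlarge: "?\<gamma> * real K ^ n \<le> cnt K n R" unfolding cntR by (simp add: mult_ac)
    have split: "(\<Sum>w\<in>cube K n. of_bool (w \<in> D) * h w)
        = (\<Sum>w\<in>cube K n. of_bool (w \<in> R) * h w) + (\<Sum>w\<in>cube K n. of_bool (w \<in> D - R) * h w)"
      for h :: "nat list \<Rightarrow> real"
      unfolding sum.distrib[symmetric] using RD by (intro sum.cong) auto
    have cntD: "cnt K n D = cnt K n R + cnt K n (D - R)"
      using split[of "\<lambda>_. 1"] unfolding cnt_def mult_1_right .
    have insD': "insens k i (t * M + r) {y. x' @ y \<in> D - R}" if "x' \<in> cube K (a + M)" for x'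
      unfolding insens_def
    proof (intro ballI impI)
      fix y y' assume y: "y \<in> cube (Suc k) (t * M + r)" "y' \<in> cube (Suc k) (t * M + r)"
        "lower k i y = lower k i y'"
      define x where "x = take a x'"
      define v where "v = drop a x'"
      have xv: "x' = x @ v" "x \<in> cube K a" "v \<in> cube K M"
        using that by (auto simp: x_def v_def words_def dest!: in_set_takeD in_set_dropD)
      have "E x y = E x y'"
      proof -
        have "x @ v @ y \<in> D \<longleftrightarrow> x @ v @ y' \<in> D" if "v \<in> cube K M" for v
          using insD[OF xv(2), of v y v y'] that y by (simp add: K_def q_def words_append)
        then show ?thesis by (auto simp: E_def)
      qed
      then have "V x y = V x y'" by (simp add: V_def good_def)
      then have "x @ v @ y \<in> R \<longleftrightarrow> x @ v @ y' \<in> R" using R[OF xv(2,3)] by simp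
      moreover have "x @ v @ y \<in> D \<longleftrightarrow> x @ v @ y' \<in> D"
        using insD[OF xv(2), of v y v y'] xv(3) y by (simp add: K_def q_def words_append)
      ultimately show "y \<in> {y. x' @ y \<in> D - R} \<longleftrightarrow> y' \<in> {y. x' @ y \<in> D - R}"
        by (simp add: xv(1))
    qed
    have n': "(a + M) + (t * M + r) = n" by (simp add: n_def q_def)
    have "(\<Sum>w\<in>cube K n. of_bool (w \<in> D - R) * g w) \<le> \<sigma> * cnt K n (D - R) +
      max (\<beta> * real K ^ n) (cnt K n (D - R) - t * ?\<gamma> * real K ^ n)"
      using Suc.IH[of "a + M" "D - R", unfolded n', OF insD'] Suc.prems(2) unfolding eq by blast
    also have "cnt K n (D - R) - t * ?\<gamma> * real K ^ n \<le> cnt K n D - Suc t * ?\<gamma> * real K ^ n"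
    proof -
      have "Suc t * ?\<gamma> * real K ^ n = t * ?\<gamma> * real K ^ n + ?\<gamma> * real K ^ n"
        unfolding of_nat_Suc distrib_right by simp
      then show ?thesis using cntD Rlarge by linarith
    qed
    finally have "(\<Sum>w\<in>cube K n. of_bool (w \<in> D - R) * g w) \<le> \<sigma> * cnt K n (D - R) +
      max (\<beta> * real K ^ n) (cnt K n D - Suc t * ?\<gamma> * real K ^ n)" by simp
    moreover have "\<sigma> * cnt K n D = \<sigma> * cnt K n R + \<sigma> * cnt K n (D - R)"
      unfolding cntD by (rule distrib_left)
    ultimately show ?thesis using split[of g] sumR unfolding eq cntR by linarith
  qed
qed

text \<open>As long as more than \<open>\<beta>\<close> is left, each block removes a proportion
  \<open>\<gamma>\<close> of the cube, so \<open>T > 1 / \<gamma>\<close> blocks exhaust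
  \<open>D\<close> up to \<open>\<beta>\<close>. The function \<open>g\<close> is bounded only from
  above, since it will be an indicator minus a constant, with \<open>\<sigma> = 0\<close>.\<close>

lemma sum_insens:
  assumes "dhj k" "0 < k" "0 < \<beta>"
  shows "\<exists>N. \<forall>n\<ge>N. \<forall>i<k. \<forall>D g \<sigma>. insens k i n D \<longrightarrow> (\<forall>w. g w \<le> 1) \<longrightarrow> 0 \<le> \<sigma> \<longrightarrow>
    (\<forall>u\<in>tmpl (Suc k) m n. (\<Sum>w\<in>cube (Suc k) m. g (inst u w)) \<le> \<sigma> * real (Suc k) ^ m) \<longrightarrow>
    (\<Sum>w\<in>cube (Suc k) n. of_bool (w \<in> D) * g w) \<le> (\<sigma> + \<beta>) * real (Suc k) ^ n"
proof -
  let ?K = "Suc k"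
  have "0 < \<beta> / 2" using assms(3) by simp
  then obtain M where M: "\<And>i D. i < k \<Longrightarrow> insens k i M D \<Longrightarrow>
      \<beta> / 2 * real ?K ^ M \<le> cnt ?K M D \<Longrightarrow> has_space ?K m M D"
    using insens_has_space[OF assms(1,2)] by meson
  define \<gamma> where "\<gamma> = \<beta> / 2 * real ?K ^ m / real ?K ^ M"
  have \<gamma>: "0 < \<gamma>" using assms(3) by (simp add: \<gamma>_def del: of_nat_Suc)
  obtain T :: nat where T: "1 < T * \<gamma>" using reals_Archimedean3[OF \<gamma>] by blast
  have "(\<Sum>w\<in>cube ?K n. of_bool (w \<in> D) * g w) \<le> (\<sigma> + \<beta>) * real ?K ^ n"
    if n: "T * M \<le> n" and i: "i < k" and D: "insens k i n D" and g: "\<And>w. g w \<le> 1" and \<sigma>: "0 \<le> \<sigma>"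
      and le: "\<And>u. u \<in> tmpl ?K m n \<Longrightarrow> (\<Sum>w\<in>cube ?K m. g (inst u w)) \<le> \<sigma> * real ?K ^ m" for n i D g \<sigma>
  proof -
    have eq: "0 + (T * M + (n - T * M)) = n" using n by simp
    have "(\<Sum>w\<in>cube ?K n. of_bool (w \<in> D) * g w) \<le> \<sigma> * cnt ?K n D +
      max (\<beta> * real ?K ^ n) (cnt ?K n D - T * \<gamma> * real ?K ^ n)"
      unfolding \<gamma>_def
      by (rule sum_insens_aux[where a = 0 and t = T and r = "n - T * M" and M = M and i = i,
          unfolded eq]) (use M i D g \<sigma> le assms n in \<open>auto simp del: of_nat_Suc\<close>)
    also have "cnt ?K n D - T * \<gamma> * real ?K ^ n \<le> \<beta> * real ?K ^ n"
    proof -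
      have "1 * real ?K ^ n \<le> T * \<gamma> * real ?K ^ n" using T by (intro mult_right_mono) auto
      moreover have "0 \<le> \<beta> * real ?K ^ n" using assms(3) by simp
      ultimately show ?thesis using cnt_le[of ?K n D] by linarith
    qed
    also have "\<sigma> * cnt ?K n D \<le> \<sigma> * real ?K ^ n" by (intro mult_left_mono \<sigma> cnt_le)
    finally show ?thesis by (simp add: distrib_right)
  qed
  then show ?thesis by blast
qed

text \<open>The last set is absorbed into the function: on every subspace of dimension
  \<open>n1\<close> the case of one set bounds the average of
  \<open>of_bool (w \<in> D j) * g w\<close>, and this product takes the place of \<open>g\<close>
  for the other \<open>j\<close> sets. So the dimension of the subspaces grows from \<open>m\<close>
  to \<open>n1\<close>, and each stage spends half of the error.\<close>

lemma sum_insens_Inter: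
  assumes "dhj k" "0 < k" "0 < \<beta>" "j \<le> k"
  shows "\<exists>N. \<forall>n\<ge>N. \<forall>D g \<sigma>. (\<forall>i<j. insens k i n (D i)) \<longrightarrow> (\<forall>w. g w \<le> 1) \<longrightarrow> 0 \<le> \<sigma> \<longrightarrow>
    (\<forall>u\<in>tmpl (Suc k) m n. (\<Sum>w\<in>cube (Suc k) m. g (inst u w)) \<le> \<sigma> * real (Suc k) ^ m) \<longrightarrow>
    (\<Sum>w\<in>cube (Suc k) n. of_bool (\<forall>i<j. w \<in> D i) * g w) \<le> (\<sigma> + \<beta>) * real (Suc k) ^ n"
  using assms(3,4)
proof (induction j arbitrary: m \<beta>)
  case 0
  let ?K = "Suc k"
  have "(\<Sum>w\<in>cube ?K n. g w) \<le> (\<sigma> + \<beta>) * real ?K ^ n"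
    if n: "m \<le> n" and \<sigma>: "0 \<le> \<sigma>"
      and le: "\<And>u. u \<in> tmpl ?K m n \<Longrightarrow> (\<Sum>w\<in>cube ?K m. g (inst u w)) \<le> \<sigma> * real ?K ^ m" for n g \<sigma>
  proof -
    have eq: "m + (n - m) = n" using n by simp
    \<comment> \<open>With no set to intersect, the cube is partitioned into the subspaces whose
      first \<open>m\<close> letters are variable.\<close>
    let ?u = "\<lambda>y. map Var [0..<m] @ map Lit y"
    have u: "?u y \<in> tmpl ?K m n" if "y \<in> cube ?K (n - m)" for y
      using that n by (auto simp: tmpl_def words_def)
    have inst_u: "inst (?u y) x = x @ y" if "x \<in> cube ?K m" for x y
      using that by (auto simp: inst_append inst_def words_length intro: nth_equalityI)
    have "(\<Sum>w\<in>cube ?K n. g w) = (\<Sum>y\<in>cube ?K (n - m). \<Sum>x\<in>cube ?K m. g (x @ y))"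
      using sum_words_append[where a = m and b = "n - m" and f = g and X = "{..<?K}", unfolded eq]
      by (simp only:) (rule sum.swap)
    also have "\<dots> \<le> (\<Sum>y\<in>cube ?K (n - m). \<sigma> * real ?K ^ m)"
    proof (rule sum_mono)
      fix y assume y: "y \<in> cube ?K (n - m)"
      show "(\<Sum>x\<in>cube ?K m. g (x @ y)) \<le> \<sigma> * real ?K ^ m"
        using le[OF u[OF y]] inst_u by (simp cong: sum.cong)
    qed
    also have "\<dots> = \<sigma> * (real ?K ^ m * real ?K ^ (n - m))" by (simp add: card_cube)
    also have "\<dots> = \<sigma> * real ?K ^ n" by (simp only: power_add[symmetric] eq)
    also have "\<dots> \<le> (\<sigma> + \<beta>) * real ?K ^ n" using 0 by (intro mult_right_mono) auto
    finally show ?thesis .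
  qed
  then show ?case by (intro exI[of _ m]) simp
next
  case (Suc j)
  let ?K = "Suc k"
  have b2: "0 < \<beta> / 2" and j: "j < k" "j \<le> k" using Suc.prems by auto
  obtain n1 where n1: "\<And>D g \<sigma>. insens k j n1 D \<Longrightarrow> (\<And>w. g w \<le> 1) \<Longrightarrow> 0 \<le> \<sigma> \<Longrightarrow>
    (\<And>u. u \<in> tmpl ?K m n1 \<Longrightarrow> (\<Sum>w\<in>cube ?K m. g (inst u w)) \<le> \<sigma> * real ?K ^ m) \<Longrightarrow>
    (\<Sum>w\<in>cube ?K n1. of_bool (w \<in> D) * g w) \<le> (\<sigma> + \<beta> / 2) * real ?K ^ n1"
    using sum_insens[OF assms(1,2) b2, of m] j(1) by (meson order_refl)
  obtain N where N: "\<And>n D g \<sigma>. N \<le> n \<Longrightarrow> (\<And>i. i < j \<Longrightarrow> insens k i n (D i)) \<Longrightarrow> (\<And>w. g w \<le> 1) \<Longrightarrow> 0 \<le> \<sigma> \<Longrightarrow>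
    (\<And>u. u \<in> tmpl ?K n1 n \<Longrightarrow> (\<Sum>w\<in>cube ?K n1. g (inst u w)) \<le> \<sigma> * real ?K ^ n1) \<Longrightarrow>
    (\<Sum>w\<in>cube ?K n. of_bool (\<forall>i<j. w \<in> D i) * g w) \<le> (\<sigma> + \<beta> / 2) * real ?K ^ n"
    using Suc.IH[OF b2 j(2), of n1] by meson
  have "(\<Sum>w\<in>cube ?K n. of_bool (\<forall>i<Suc j. w \<in> D i) * g w) \<le> (\<sigma> + \<beta>) * real ?K ^ n"
    if n: "N \<le> n" and D: "\<And>i. i < Suc j \<Longrightarrow> insens k i n (D i)" and g: "\<And>w. g w \<le> 1" and \<sigma>: "0 \<le> \<sigma>"
      and le: "\<And>u. u \<in> tmpl ?K m n \<Longrightarrow> (\<Sum>w\<in>cube ?K m. g (inst u w)) \<le> \<sigma> * real ?K ^ m" for n D g \<sigma>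
  proof -
    have "(\<Sum>w\<in>cube ?K n. of_bool (\<forall>i<Suc j. w \<in> D i) * g w)
        = (\<Sum>w\<in>cube ?K n. of_bool (\<forall>i<j. w \<in> D i) * (of_bool (w \<in> D j) * g w))"
      by (intro sum.cong) (auto simp: less_Suc_eq)
    also have "\<dots> \<le> ((\<sigma> + \<beta> / 2) + \<beta> / 2) * real ?K ^ n"
    proof (rule N[OF n])
      show "insens k i n (D i)" if "i < j" for i using D that by simp
      show "of_bool (w \<in> D j) * g w \<le> 1" for w using g[of w] by simp
      show "0 \<le> \<sigma> + \<beta> / 2" using \<sigma> b2 by simp
      fix u assume u: "u \<in> tmpl ?K n1 n"
      have "(\<Sum>w\<in>cube ?K n1. of_bool (w \<in> {w. inst u w \<in> D j}) * g (inst u w))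
        \<le> (\<sigma> + \<beta> / 2) * real ?K ^ n1"
      proof (rule n1)
        show "insens k j n1 {w. inst u w \<in> D j}" by (rule insens_pullback[OF D u]) simp
        fix s assume s: "s \<in> tmpl ?K m n1"
        then have "length s = n1" by (simp add: tmpl_def)
        then show "(\<Sum>w\<in>cube ?K m. g (inst u (inst s w))) \<le> \<sigma> * real ?K ^ m"
          using le[OF subst_tmpl[OF u s]] by (simp add: inst_subst[OF u])
      qed (use g \<sigma> in auto)
      then show "(\<Sum>w\<in>cube ?K n1. of_bool (inst u w \<in> D j) * g (inst u w))
        \<le> (\<sigma> + \<beta> / 2) * real ?K ^ n1" by (simp only: mem_Collect_eq)
    qed
    also have "(\<sigma> + \<beta> / 2) + \<beta> / 2 = \<sigma> + \<beta>" by simp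
    finally show ?thesis .
  qed
  then show ?case by blast
qed

subsection \<open>The density Hales--Jewett theorem\<close>

lemma insens_Compl: "insens k i n (- D) \<longleftrightarrow> insens k i n D"
  by (simp only: insens_def Compl_iff not_iff not_not) blast

text \<open>The complement of the intersection of the \<open>C i\<close> splits into
  \<open>k\<close> pieces by the first \<open>j\<close> with \<open>w \<notin> C j\<close>, each an
  intersection of \<open>j + 1\<close> insensitive sets. On each piece the excess of the indicator
  of \<open>B\<close> over \<open>\<rho>\<close> sums to at most \<open>\<beta>\<close> times the
  size of the cube, and \<open>B\<close> lies in the complement. The bound stays a sum over words,
  so that it can be summed further over the other blocks.\<close>

lemma cnt_avoid_insens:
  fixes \<beta> :: real
  assumes "dhj k" "0 < k" "0 < \<beta>"
  shows "\<exists>N. \<forall>n\<ge>N. \<forall>B C \<rho>. (\<forall>i<k. insens k i n (C i)) \<longrightarrow> 0 \<le> \<rho> \<longrightarrow>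
    (\<forall>u\<in>tmpl (Suc k) m n. cnt (Suc k) m {w. inst u w \<in> B} \<le> \<rho> * real (Suc k) ^ m) \<longrightarrow>
    (\<forall>w\<in>cube (Suc k) n. w \<in> B \<longrightarrow> (\<exists>i<k. w \<notin> C i)) \<longrightarrow>
    cnt (Suc k) n B \<le>
      (\<Sum>w\<in>cube (Suc k) n. \<rho> * (1 - of_bool (\<forall>i<k. w \<in> C i)) + k * \<beta>)"
proof -
  let ?K = "Suc k"
  define good where "good j n \<longleftrightarrow> (\<forall>D g \<sigma>. (\<forall>i<Suc j. insens k i n (D i)) \<longrightarrow> (\<forall>w. g w \<le> 1) \<longrightarrow> 0 \<le> \<sigma> \<longrightarrow>
    (\<forall>u\<in>tmpl ?K m n. (\<Sum>w\<in>cube ?K m. g (inst u w)) \<le> \<sigma> * real ?K ^ m) \<longrightarrow>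
    (\<Sum>w\<in>cube ?K n. of_bool (\<forall>i<Suc j. w \<in> D i) * g w) \<le> (\<sigma> + \<beta>) * real ?K ^ n)" for j n
  have "\<exists>N. \<forall>n\<ge>N. good j n" if "j < k" for j
    unfolding good_def by (rule sum_insens_Inter[OF assms]) (use that in simp)
  then obtain N where N: "\<And>j n. j < k \<Longrightarrow> N j \<le> n \<Longrightarrow> good j n" by metis
  have "cnt ?K n B \<le> (\<Sum>w\<in>cube ?K n. \<rho> * (1 - of_bool (\<forall>i<k. w \<in> C i)) + k * \<beta>)"
    if n: "Max (N ` {..<k}) \<le> n" and C: "\<And>i. i < k \<Longrightarrow> insens k i n (C i)" and \<rho>: "0 \<le> \<rho>"
      and le: "\<And>u. u \<in> tmpl ?K m n \<Longrightarrow> cnt ?K m {w. inst u w \<in> B} \<le> \<rho> * real ?K ^ m"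
      and BC: "\<And>w. w \<in> cube ?K n \<Longrightarrow> w \<in> B \<Longrightarrow> \<exists>i<k. w \<notin> C i" for n B C \<rho>
  proof -
    define g :: "nat list \<Rightarrow> real" where "g w = of_bool (w \<in> B) - \<rho>" for w
    define D where "D j i = (if i = j then - C j else C i)" for j i
    have D: "(\<Sum>j<l. of_bool (\<forall>i<Suc j. w \<in> D j i)) = (of_bool (\<exists>i<l. w \<notin> C i) :: real)" for l w
    proof (induction l)
      case (Suc l)
      have "(\<forall>i<Suc l. w \<in> D l i) \<longleftrightarrow> (\<forall>i<l. w \<in> C i) \<and> w \<notin> C l"
        by (auto simp: D_def less_Suc_eq)
      moreover have "(\<exists>i<Suc l. w \<notin> C i) \<longleftrightarrow> (\<exists>i<l. w \<notin> C i) \<or> w \<notin> C l"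
        by (auto simp: less_Suc_eq)
      ultimately show ?case unfolding sum.lessThan_Suc Suc.IH by auto
    qed simp
    have "(\<Sum>w\<in>cube ?K n. of_bool (\<forall>i<Suc j. w \<in> D j i) * g w) \<le> (0 + \<beta>) * real ?K ^ n"
      if "j < k" for j
    proof -
      have "N j \<le> Max (N ` {..<k})" using that by (intro Max_ge) auto
      then have "N j \<le> n" using n by (rule order_trans)
      then have "good j n" by (rule N[OF that])
      moreover have "insens k i n (D j i)" if "i < Suc j" for i
        using C[of i] \<open>j < k\<close> that by (cases "i = j") (auto simp: D_def insens_Compl)
      moreover have "g w \<le> 1" for w using \<rho> by (simp add: g_def)
      moreover have "(\<Sum>w\<in>cube ?K m. g (inst u w)) \<le> 0 * real ?K ^ m" if "u \<in> tmpl ?K m n" for u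
      proof -
        have "(\<Sum>w\<in>cube ?K m. g (inst u w)) = cnt ?K m {w. inst u w \<in> B} - \<rho> * real ?K ^ m"
          unfolding g_def sum_subtractf cnt_def mem_Collect_eq by (simp add: card_cube)
        then show ?thesis using le[OF that] by simp
      qed
      ultimately show ?thesis unfolding good_def by blast
    qed
    then have "(\<Sum>j<k. \<Sum>w\<in>cube ?K n. of_bool (\<forall>i<Suc j. w \<in> D j i) * g w) \<le> (\<Sum>j<k. \<beta> * real ?K ^ n)"
      by (intro sum_mono) simp
    also have "(\<Sum>j<k. \<Sum>w\<in>cube ?K n. of_bool (\<forall>i<Suc j. w \<in> D j i) * g w)
        = (\<Sum>w\<in>cube ?K n. of_bool (\<exists>i<k. w \<notin> C i) * g w)"
      unfolding D[symmetric] sum_distrib_right by (rule sum.swap)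
    also have "\<dots> = (\<Sum>w\<in>cube ?K n. of_bool (w \<in> B) - \<rho> * (1 - of_bool (\<forall>i<k. w \<in> C i)))"
      using BC by (intro sum.cong) (auto simp: g_def)
    also have "\<dots> = cnt ?K n B - (\<Sum>w\<in>cube ?K n. \<rho> * (1 - of_bool (\<forall>i<k. w \<in> C i)))"
      unfolding sum_subtractf cnt_def ..
    finally have "cnt ?K n B - (\<Sum>w\<in>cube ?K n. \<rho> * (1 - of_bool (\<forall>i<k. w \<in> C i)))
      \<le> (\<Sum>w\<in>cube ?K n. k * \<beta>)" by (simp add: card_cube mult_ac)
    then show ?thesis unfolding sum.distrib by linarith
  qed
  then show ?thesis by blast
qed

text \<open>
  Words are cut into blocks. A block consists of a letter \<open>c\<close> and a word \<open>y\<close> over \<open>[k+1]\<close> in which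
  each \<open>k\<close> is replaced by \<open>c\<close>: a line in the letters \<open>c\<close> over \<open>[k]\<close> thus becomes a line over
  \<open>[k+1]\<close>, whose last point contains the words \<open>y\<close> of the active blocks unchanged.
\<close>

definition blocks :: "nat \<Rightarrow> nat list \<Rightarrow> nat list list \<Rightarrow> nat list" where
  "blocks k u Y = concat (map2 (\<lambda>c y. c # lower k c y) u Y)"

fun sym_block :: "nat \<Rightarrow> sym \<Rightarrow> nat list \<Rightarrow> sym list" where
  "sym_block k (Lit c) y = map Lit (c # lower k c y)"
| "sym_block k (Var j) y = Var j # map (\<lambda>a. if a = k then Var j else Lit a) y"

definition sym_blocks :: "nat \<Rightarrow> sym list \<Rightarrow> nat list list \<Rightarrow> sym list" where
  "sym_blocks k e Y = concat (map2 (sym_block k) e Y)"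

text \<open>\<open>w\<close> is arbitrary, so the parameter \<open>k\<close> is included: the
  instance at \<open>[k]\<close> is the point that a line over \<open>[k+1]\<close> has beyond those
  of a line over \<open>[k]\<close>.\<close>

lemma inst_sym_blocks: "inst (sym_blocks k e Y) w = blocks k (inst e w) Y"
proof -
  have "inst (sym_block k x y) w = sval w x # lower k (sval w x) y" for x y
    by (cases x) (auto simp: inst_def)
  then show ?thesis
    by (simp add: sym_blocks_def blocks_def inst_def map_concat zip_map1 case_prod_beta comp_def
        cong: if_cong)
qed

lemma blocks_append:
  "length u = length Y \<Longrightarrow> blocks k (u @ u') (Y @ Y') = blocks k u Y @ blocks k u' Y'"
  by (simp add: blocks_def)

lemma blocks_cube:
  assumes "u \<in> cube (Suc k) m" "Y \<in> words (cube (Suc k) N) m"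
  shows "blocks k u Y \<in> cube (Suc k) (m * Suc N)"
proof -
  have "length u = length Y" using assms by (simp add: words_length)
  moreover have "set u \<subseteq> {..<Suc k}" "set Y \<subseteq> cube (Suc k) N" "length Y = m"
    using assms by (auto simp: words_def)
  ultimately show ?thesis
  proof (induction u Y arbitrary: m rule: list_induct2)
    case (Cons c u y Y)
    then obtain m' where "m = Suc m'" "length Y = m'" by auto
    moreover have "blocks k u Y \<in> cube (Suc k) (m' * Suc N)" using Cons calculation by auto
    moreover have "c # lower k c y \<in> cube (Suc k) (Suc N)" using Cons.prems by (auto simp: words_def)
    ultimately show ?case
      using words_append[of "c # lower k c y" _ "Suc N" "blocks k u Y" "m' * Suc N"]
      by (simp add: blocks_def ac_simps)
  qed (simp add: blocks_def)
qed

text \<open>Each block begins with its own symbol, so a variable of \<open>e\<close> occurs even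
  where the block word contains no \<open>k\<close>.\<close>

lemma sym_blocks_tmpl:
  assumes "e \<in> tmpl k l m" "Y \<in> words (cube (Suc k) N) m"
  shows "sym_blocks k e Y \<in> tmpl (Suc k) l (m * Suc N)"
proof -
  have "length e = length Y" using assms by (simp add: words_length tmpl_def)
  moreover have "\<forall>c. Lit c \<in> set e \<longrightarrow> c < Suc k" "set Y \<subseteq> cube (Suc k) N" "length Y = m"
    using assms by (auto simp: words_def tmpl_def)
  ultimately have "length (sym_blocks k e Y) = m * Suc N
      \<and> (\<forall>c. Lit c \<in> set (sym_blocks k e Y) \<longrightarrow> c < Suc k)
      \<and> (\<forall>j. Var j \<in> set (sym_blocks k e Y) \<longleftrightarrow> Var j \<in> set e)"
  proof (induction e Y arbitrary: m rule: list_induct2)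
    case (Cons x e y Y)
    have y: "length y = N" "set y \<subseteq> {..<Suc k}" using Cons.prems by (auto simp: words_def)
    have "sym_blocks k (x # e) (y # Y) = sym_block k x y @ sym_blocks k e Y"
      by (simp add: sym_blocks_def)
    moreover have "length (sym_blocks k e Y) = length Y * Suc N
      \<and> (\<forall>c. Lit c \<in> set (sym_blocks k e Y) \<longrightarrow> c < Suc k)
      \<and> (\<forall>j. Var j \<in> set (sym_blocks k e Y) \<longleftrightarrow> Var j \<in> set e)"
      using Cons.prems by (intro Cons.IH) auto
    moreover have "length (sym_block k x y) = Suc N" using y by (cases x) auto
    moreover have "c < Suc k" if "Lit c \<in> set (sym_block k x y)" for c
      using that y Cons.prems(1) by (cases x rule: sym.exhaust) (auto split: if_splits)
    moreover have "Var j \<in> set (sym_block k x y) \<longleftrightarrow> x = Var j" for j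
      by (cases x) (auto split: if_splits)
    moreover have "m = Suc (length Y)" using Cons.prems by simp
    ultimately show ?case by auto
  qed (simp add: sym_blocks_def)
  then show ?thesis using assms(1) by (auto simp: tmpl_def)
qed

section \<open>Extremal density and the step to one more letter\<close>

lemma has_space_extend:
  assumes "\<And>A. d * real k ^ a \<le> cnt k a A \<Longrightarrow> has_space k m a A"
    and "0 < k" "a \<le> n" "d * real k ^ n \<le> cnt k n A"
  shows "has_space k m n A"
proof -
  define b where "b = n - a"
  have n: "n = a + b" using assms(3) by (simp add: b_def)
  have "d * real k ^ a * card (cube k b) \<le> (\<Sum>y\<in>cube k b. cnt k a {x. x @ y \<in> A})"
    using assms(4) unfolding n cnt_append' by (simp add: card_cube power_add)
  then obtain y where y: "y \<in> cube k b" "d * real k ^ a \<le> cnt k a {x. x @ y \<in> A}"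
    by (rule average_witness[rotated 2]) (use assms cube_nonempty in auto)
  then have "has_space k m a {x. [] @ x @ y \<in> A}" using assms(1) by simp
  from has_space_slice[OF _ y(1) this, of 0] show ?thesis by (simp add: n)
qed

lemma sum_words_middle:
  "(\<Sum>Y\<in>words X (b + Suc d). h Y) = (\<Sum>Y1\<in>words X b. \<Sum>Y2\<in>words X d. \<Sum>y\<in>X. h (Y1 @ y # Y2))"
  unfolding sum_words_append sum_words_Suc by (rule sum.cong[OF refl]) (rule sum.swap)

text \<open>\<open>Y\<close> lists the block words and \<open>z\<close> is the rest of the word. The
  point with letter \<open>c < k\<close> sees an active block word \<open>y\<close> only through
  \<open>lower k c y\<close>, while the point with letter \<open>k\<close> sees \<open>y\<close>
  itself. When all blocks but one active block are fixed, membership of the first \<open>k\<close>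
  points in \<open>A\<close> therefore defines an intersection of insensitive sets, which the last
  point has to avoid.\<close>

lemma dhj_Suc:
  assumes "dhj k" "0 < k"
  shows "dhj (Suc k)"
proof (rule ccontr)
  assume neg: "\<not> dhj (Suc k)"
  let ?K = "Suc k"
  \<comment> \<open>If \<open>\<delta>\<close> is the supremum of the densities attained by line-free sets in all dimensions, a set of
    density almost \<open>\<delta>\<close> in a huge dimension has density almost \<open>\<delta>\<close> on every section by a short
    prefix, since no section can exceed \<open>\<delta>\<close> by much.\<close>
  define S where "S = {d. \<forall>n. \<exists>A. d * real ?K ^ n \<le> cnt ?K n A \<and> \<not> has_space ?K 1 n A}"
  obtain \<delta>0 where \<delta>0: "0 < \<delta>0" "\<delta>0 \<in> S" using neg unfolding dhj_def S_def by blast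
  have S1: "d \<le> 1" if dS: "d \<in> S" for d
  proof -
    obtain A where "d * real ?K ^ 0 \<le> cnt ?K 0 A" using dS unfolding S_def by blast
    then show ?thesis using cnt_le[of ?K 0 A] by simp
  qed
  then have bdd: "bdd_above S" by (rule bdd_aboveI)
  define \<delta> where "\<delta> = Sup S"
  have "\<delta>0 \<le> \<delta>" unfolding \<delta>_def using \<delta>0 bdd by (intro cSup_upper)
  then have \<delta>: "0 < \<delta>" using \<delta>0 by simp
  have "\<delta> \<le> 1" unfolding \<delta>_def using \<delta>0 S1 by (intro cSup_least) auto
  have lo: "\<exists>A. (\<delta> - e) * real ?K ^ n \<le> cnt ?K n A \<and> \<not> has_space ?K 1 n A" if "0 < e" for e n
  proof -
    have "\<delta> - e < Sup S" using that by (simp add: \<delta>_def)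
    then obtain d where d: "d \<in> S" "\<delta> - e < d" using less_cSup_iff[OF _ bdd] \<delta>0 by blast
    then obtain A where A: "d * real ?K ^ n \<le> cnt ?K n A" "\<not> has_space ?K 1 n A"
      unfolding S_def by blast
    have "(\<delta> - e) * real ?K ^ n \<le> d * real ?K ^ n" using d by (intro mult_right_mono) auto
    then show ?thesis using A order_trans by blast
  qed
  have up: "\<exists>a. \<forall>n\<ge>a. \<forall>A. \<not> has_space ?K 1 n A \<longrightarrow> cnt ?K n A < (\<delta> + e) * real ?K ^ n" if "0 < e" for e
  proof -
    have "\<delta> + e \<notin> S" using cSup_upper[OF _ bdd, of "\<delta> + e"] that by (auto simp: \<delta>_def)
    then obtain a where a: "\<And>A. (\<delta> + e) * real ?K ^ a \<le> cnt ?K a A \<Longrightarrow> has_space ?K 1 a A"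
      unfolding S_def by blast
    show ?thesis using has_space_extend[OF a] by (intro exI[of _ a]) (auto simp: not_le[symmetric])
  qed

  have "0 < \<delta> / 2" using \<delta> by simp
  then obtain m where m: "\<And>A. \<delta> / 2 * real k ^ m \<le> cnt k m A \<Longrightarrow> has_space k 1 m A"
    using assms(1) unfolding dhj_def by meson
  define T where "T = tmpl k 1 m"
  \<comment> \<open>\<open>\<theta>\<close> will bound from below the proportion of pairs
    \<open>(Y, z)\<close> for which one fixed line \<open>e\<close> has its first \<open>k\<close>
    points in \<open>A\<close>. The final comparison loses less than \<open>3 * \<kappa>\<close>,
    and \<open>\<kappa>\<close> is chosen to make
    \<open>\<delta> * \<theta> = 4 * \<kappa>\<close>.\<close>
  define \<theta> where "\<theta> = \<delta> / 4 / (card T + 1)"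
  define \<kappa> where "\<kappa> = \<delta> * \<theta> / 4"
  have \<theta>: "0 < \<theta>" "\<theta> \<le> 1"
    using \<delta> \<open>\<delta> \<le> 1\<close> by (auto simp: \<theta>_def field_simps)
  have "\<delta> * \<theta> \<le> \<delta>" using \<delta> \<theta> by (intro mult_left_le) auto
  then have \<kappa>: "0 < \<kappa>" "\<kappa> \<le> \<delta> / 4" using \<delta> \<theta> by (auto simp: \<kappa>_def)
  define \<rho> where "\<rho> = \<delta> + \<kappa>"
  define \<beta> where "\<beta> = \<kappa> / k"
  have \<beta>: "0 < \<beta>" "k * \<beta> = \<kappa>" using \<kappa> assms(2) by (auto simp: \<beta>_def)
  obtain m1 where m1: "\<And>A. \<not> has_space ?K 1 m1 A \<Longrightarrow> cnt ?K m1 A < \<rho> * real ?K ^ m1"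
    using up[OF \<kappa>(1)] unfolding \<rho>_def by blast
  have \<rho>: "0 \<le> \<rho>" using \<delta> \<kappa> by (simp add: \<rho>_def)
  obtain N where N0: "\<forall>n\<ge>N. \<forall>B C \<rho>. (\<forall>i<k. insens k i n (C i)) \<longrightarrow> 0 \<le> \<rho> \<longrightarrow>
    (\<forall>u\<in>tmpl ?K m1 n. cnt ?K m1 {w. inst u w \<in> B} \<le> \<rho> * real ?K ^ m1) \<longrightarrow>
    (\<forall>w\<in>cube ?K n. w \<in> B \<longrightarrow> (\<exists>i<k. w \<notin> C i)) \<longrightarrow>
    cnt ?K n B \<le> (\<Sum>w\<in>cube ?K n. \<rho> * (1 - of_bool (\<forall>i<k. w \<in> C i)) + k * \<beta>)"
    using cnt_avoid_insens[OF assms \<beta>(1), of m1] by (elim exE) (rule that)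
  have N: "cnt ?K N B \<le> (\<Sum>w\<in>cube ?K N. \<rho> * (1 - of_bool (\<forall>i<k. w \<in> C i)) + \<kappa>)"
    if "\<And>i. i < k \<Longrightarrow> insens k i N (C i)"
      "\<And>u. u \<in> tmpl ?K m1 N \<Longrightarrow> cnt ?K m1 {w. inst u w \<in> B} \<le> \<rho> * real ?K ^ m1"
      "\<And>w. w \<in> cube ?K N \<Longrightarrow> w \<in> B \<Longrightarrow> (\<exists>i<k. w \<notin> C i)" for B C
    using N0[rule_format, of N C \<rho> B] that \<rho> unfolding \<beta>(2) by simp
  define L where "L = m * Suc N"
  \<comment> \<open>Every section has density below \<open>\<delta> + e0\<close> and their mean is
    at least \<open>\<delta> - e0\<close>, so one of the \<open>Suc k ^ L\<close> sections can fall
    short by at most \<open>2 * e0 * Suc k ^ L = \<kappa>\<close>.\<close>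
  define e0 where "e0 = \<kappa> / (2 * real ?K ^ L)"
  have e0: "0 < e0" using \<kappa> by (simp add: e0_def del: of_nat_Suc)
  obtain r where r: "\<And>A. \<not> has_space ?K 1 r A \<Longrightarrow> cnt ?K r A < (\<delta> + e0) * real ?K ^ r"
    using up[OF e0] by blast
  obtain A where A: "(\<delta> - e0) * real ?K ^ (L + r) \<le> cnt ?K (L + r) A" "\<not> has_space ?K 1 (L + r) A"
    using lo[OF e0] by blast

  \<comment> \<open>This holds for every prefix and not just for most, so it applies to the prefixes
    produced by \<open>blocks\<close>, however unevenly these are distributed in the cube.\<close>
  have slice: "(\<delta> - \<kappa>) * real ?K ^ r \<le> cnt ?K r {z. x @ z \<in> A}" if x: "x \<in> cube ?K L" for x
  proof -
    let ?f = "\<lambda>x. cnt ?K r {z. x @ z \<in> A}"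
    have le: "?f x' \<le> (\<delta> + e0) * real ?K ^ r" if "x' \<in> cube ?K L" for x'
    proof -
      have "\<not> has_space ?K 1 r {z. x' @ z @ [] \<in> A}"
        using has_space_slice[OF that, of "[]" 0 1 r A] A(2) by auto
      then show ?thesis using r[of "{z. x' @ z \<in> A}"] by simp
    qed
    have KL: "real ?K ^ L \<noteq> 0" by (simp del: of_nat_Suc)
    have "(\<delta> - e0) * real ?K ^ (L + r) \<le> (\<Sum>x'\<in>cube ?K L. ?f x')"
      using A(1) unfolding cnt_append .
    also have "\<dots> = ?f x + (\<Sum>x'\<in>cube ?K L - {x}. ?f x')"
      using x by (intro sum.remove) auto
    also have "(\<Sum>x'\<in>cube ?K L - {x}. ?f x') \<le> of_nat (card (cube ?K L - {x})) * ((\<delta> + e0) * real ?K ^ r)"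
      using le by (intro sum_bounded_above) auto
    also have "of_nat (card (cube ?K L - {x})) = real ?K ^ L - 1"
      using x by (simp add: card_cube of_nat_diff del: of_nat_Suc)
    finally have "(\<delta> - e0) * (real ?K ^ L * real ?K ^ r) \<le> ?f x + (real ?K ^ L - 1) * ((\<delta> + e0) * real ?K ^ r)"
      by (simp add: power_add)
    then have "(\<delta> + e0) * real ?K ^ r - (2 * real ?K ^ L * e0) * real ?K ^ r \<le> ?f x"
      by (simp add: algebra_simps del: of_nat_Suc)
    also have "2 * real ?K ^ L * e0 = \<kappa>" using KL by (simp add: e0_def del: of_nat_Suc)
    finally have "(\<delta> - \<kappa>) * real ?K ^ r + e0 * real ?K ^ r \<le> ?f x"
      by (simp add: algebra_simps del: of_nat_Suc)
    moreover have "0 \<le> e0 * real ?K ^ r" using e0 by simp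
    ultimately show ?thesis by linarith
  qed

  define W where "W = words (cube ?K N) m"
  define P where "P e Y z \<longleftrightarrow> (\<forall>c<k. blocks k (inst e [c]) Y @ z \<in> A)" for e Y z
  have finW: "finite W" by (simp add: W_def)
  have cardW: "0 < card W" by (simp add: W_def card_words card_cube)
  have many: "\<delta> / 4 * card (cube ?K r) \<le> (\<Sum>z\<in>cube ?K r. \<Sum>e\<in>T. of_bool (P e Y z))" if Y: "Y \<in> W" for Y
  proof -
    let ?f = "\<lambda>z. cnt k m {u. blocks k u Y @ z \<in> A}"
    \<comment> \<open>The density \<open>\<delta> - \<kappa>\<close> is at least
      \<open>3 * \<delta> / 4\<close>; it is split into the threshold \<open>\<delta> / 2\<close>,
      for which \<open>m\<close> was chosen, and the proportion \<open>\<delta> / 4\<close> of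
      suffixes that reach it.\<close>
    have "\<delta> / 4 * card (cube ?K r) \<le> (\<Sum>z\<in>cube ?K r. of_bool (\<delta> / 2 * real k ^ m \<le> ?f z))"
    proof (rule markov)
      have blk: "blocks k u Y \<in> cube ?K L" if "u \<in> cube k m" for u
        using that Y unfolding L_def W_def by (intro blocks_cube) (auto simp: words_def)
      have "(\<delta> / 2 + \<delta> / 4) * real k ^ m * card (cube ?K r) \<le> (\<delta> - \<kappa>) * (real k ^ m * card (cube ?K r))"
        unfolding mult.assoc using \<kappa>(2) by (intro mult_right_mono) auto
      also have "\<dots> = (\<Sum>u\<in>cube k m. (\<delta> - \<kappa>) * real ?K ^ r)" by (simp add: card_cube)
      also have "\<dots> \<le> (\<Sum>u\<in>cube k m. cnt ?K r {z. blocks k u Y @ z \<in> A})"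
        by (intro sum_mono slice blk)
      also have "\<dots> = (\<Sum>z\<in>cube ?K r. ?f z)"
        unfolding cnt_def mem_Collect_eq by (rule sum.swap)
      finally show "(\<delta> / 2 + \<delta> / 4) * real k ^ m * card (cube ?K r) \<le> (\<Sum>z\<in>cube ?K r. ?f z)" .
    qed (use \<delta> assms(2) cnt_le in auto)
    also have "\<dots> \<le> (\<Sum>z\<in>cube ?K r. \<Sum>e\<in>T. of_bool (P e Y z))"
    proof (rule sum_mono)
      fix z
      show "of_bool (\<delta> / 2 * real k ^ m \<le> ?f z) \<le> (\<Sum>e\<in>T. of_bool (P e Y z) :: real)"
      proof (cases "\<delta> / 2 * real k ^ m \<le> ?f z")
        case True
        then obtain e where e: "e \<in> T" "\<forall>w\<in>cube k 1. blocks k (inst e w) Y @ z \<in> A"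
          using m unfolding has_space_def T_def by blast
        have "[c] \<in> cube k 1" if "c < k" for c using that by (simp add: words_def)
        then have "P e Y z" unfolding P_def using e(2) by blast
        moreover have "of_bool (P e Y z) \<le> (\<Sum>e\<in>T. of_bool (P e Y z) :: real)"
          using e(1) by (intro member_le_sum) (auto simp: T_def)
        ultimately show ?thesis using True by (simp only: of_bool_eq)
      next
        case False
        then show ?thesis by (simp only: of_bool_eq) (intro sum_nonneg, simp)
      qed
    qed
    finally show ?thesis .
  qed
  define X where "X = card W * real ?K ^ r"
  have X: "0 < X" using cardW by (simp add: X_def del: of_nat_Suc)
  have "(\<Sum>Y\<in>W. \<delta> / 4 * card (cube ?K r)) \<le> (\<Sum>Y\<in>W. \<Sum>z\<in>cube ?K r. \<Sum>e\<in>T. of_bool (P e Y z))"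
    by (intro sum_mono many)
  also have "\<dots> = (\<Sum>Y\<in>W. \<Sum>e\<in>T. \<Sum>z\<in>cube ?K r. of_bool (P e Y z))"
    by (intro sum.cong refl sum.swap)
  also have "\<dots> = (\<Sum>e\<in>T. \<Sum>Y\<in>W. \<Sum>z\<in>cube ?K r. of_bool (P e Y z))" by (rule sum.swap)
  finally have tot: "\<delta> / 4 * X \<le> (\<Sum>e\<in>T. \<Sum>Y\<in>W. \<Sum>z\<in>cube ?K r. of_bool (P e Y z))"
    by (simp add: X_def card_cube mult_ac del: of_nat_Suc)
  obtain e where e: "e \<in> T" "\<theta> * X \<le> (\<Sum>Y\<in>W. \<Sum>z\<in>cube ?K r. of_bool (P e Y z))"
  proof (rule average_witness[of T "\<theta> * X" "\<lambda>e. \<Sum>Y\<in>W. \<Sum>z\<in>cube ?K r. of_bool (P e Y z)"])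
    show "finite T" by (simp add: T_def)
    have "0 < \<delta> / 4 * X" using X \<delta> by simp
    then show "T \<noteq> {}" using tot by force
    have "\<theta> * card T \<le> \<delta> / 4" using \<delta> by (simp add: \<theta>_def field_simps)
    then have "\<theta> * card T * X \<le> \<delta> / 4 * X" using X by (intro mult_right_mono) auto
    then show "\<theta> * X * card T \<le> (\<Sum>e\<in>T. \<Sum>Y\<in>W. \<Sum>z\<in>cube ?K r. of_bool (P e Y z))"
      using tot by (simp add: mult_ac)
  qed
  have eT: "e \<in> tmpl k 1 m" using e(1) by (simp add: T_def)
  then have "Var 0 \<in> set e" by (simp add: tmpl_def)
  \<comment> \<open>A single active block is varied; other active blocks of \<open>e\<close> count
    among the fixed words \<open>Y1\<close> and \<open>Y2\<close>.\<close>
  then obtain e1 e2 where e12: "e = e1 @ Var 0 # e2" by (meson split_list)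
  define b d where "b = length e1" and "d = length e2"
  have mbd: "m = b + Suc d" using eT by (simp add: tmpl_def e12 b_def d_def)
  define Q where "Q Y z \<longleftrightarrow> blocks k (inst e [k]) Y @ z \<in> A" for Y z
  have ik: "inst e' [c] \<in> cube ?K (length e')" if "set e' \<subseteq> set e" "c \<le> k" for e' c
  proof -
    have "sval [c] x < ?K" if "x \<in> set e'" for x
      using that eT \<open>set e' \<subseteq> set e\<close> \<open>c \<le> k\<close> by (cases x rule: sym.exhaust) (auto simp: tmpl_def)
    then show ?thesis by (auto simp: inst_def words_def)
  qed
  have key: "(\<Sum>y\<in>cube ?K N. of_bool (Q (Y1 @ y # Y2) z))
      \<le> (\<Sum>y\<in>cube ?K N. \<rho> * (1 - of_bool (P e (Y1 @ y # Y2) z)) + \<kappa>)"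
    if Y1: "Y1 \<in> words (cube ?K N) b" and Y2: "Y2 \<in> words (cube ?K N) d" and z: "z \<in> cube ?K r" for Y1 Y2 z
  proof -
    define pre suf where "pre c = blocks k (inst e1 [c]) Y1 @ [c]"
      and "suf c = blocks k (inst e2 [c]) Y2 @ z" for c
    have dec: "blocks k (inst e [c]) (Y1 @ y # Y2) @ z = pre c @ lower k c y @ suf c" for c y
    proof -
      have "length (inst e1 [c]) = length Y1" using Y1 by (simp add: inst_def b_def words_length)
      then show ?thesis
        unfolding e12 inst_append using blocks_append[of "inst e1 [c]" Y1 k]
        by (simp add: pre_def suf_def inst_def blocks_def)
    qed
    define B where "B = {y. pre k @ y @ suf k \<in> A}"
    define C where "C c = {y. pre c @ lower k c y @ suf c \<in> A}" for c
    \<comment> \<open>For \<open>c = k\<close> nothing is replaced, so \<open>B\<close> is the case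
      \<open>c = k\<close> of the formula for \<open>C\<close>.\<close>
    have low: "lower k k y = y" for y by (induction y) auto
    have pre: "pre k \<in> cube ?K (b * Suc N + 1)" unfolding pre_def
      using blocks_cube[OF ik[of e1 k] Y1[unfolded b_def]]
      by (intro words_append) (auto simp: e12 b_def words_def)
    have suf: "suf k \<in> cube ?K (d * Suc N + r)" unfolding suf_def
      using blocks_cube[OF ik[of e2 k] Y2[unfolded d_def]]
      by (intro words_append z) (auto simp: e12 d_def)
    have dim: "(b * Suc N + 1) + (N + (d * Suc N + r)) = L + r" by (simp add: L_def mbd algebra_simps)
    have noB: "\<not> has_space ?K 1 N B"
      using has_space_slice[OF pre suf, of 1 N A] A(2) unfolding B_def dim by blast
    have "cnt ?K N B \<le> (\<Sum>w\<in>cube ?K N. \<rho> * (1 - of_bool (\<forall>i<k. w \<in> C i)) + \<kappa>)"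
    proof (rule N)
      show "insens k i N (C i)" for i by (simp add: insens_def C_def)
      show "cnt ?K m1 {w. inst u w \<in> B} \<le> \<rho> * real ?K ^ m1" if "u \<in> tmpl ?K m1 N" for u
        using m1 has_space_pullback[OF that] noB by (metis less_imp_le)
      fix y assume y: "y \<in> cube ?K N" "y \<in> B"
      show "\<exists>i<k. y \<notin> C i"
      proof (rule ccontr)
        assume "\<not> (\<exists>i<k. y \<notin> C i)"
        then have all: "blocks k (inst e [c]) (Y1 @ y # Y2) @ z \<in> A" if "c \<le> k" for c
          using that y(2) unfolding dec by (cases "c = k") (auto simp: B_def C_def low)
        have "Y1 @ y # Y2 \<in> words (cube ?K N) m"
          unfolding mbd using Y1 Y2 y(1) by (auto simp: words_def)
        then have "sym_blocks k e (Y1 @ y # Y2) \<in> tmpl ?K 1 L"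
          unfolding L_def by (rule sym_blocks_tmpl[OF eT])
        then have t: "[] @ sym_blocks k e (Y1 @ y # Y2) @ map Lit z \<in> tmpl ?K 1 (0 + (L + r))"
          using tmpl_Lit_append[of _ ?K 1 L "[]" 0 z r] z by simp
        have "inst (sym_blocks k e (Y1 @ y # Y2) @ map Lit z) w \<in> A" if w: "w \<in> cube ?K 1" for w
        proof -
          obtain c where "w = [c]" "c \<le> k" using w by (auto simp: words_def length_Suc_conv)
          then show ?thesis using all by (simp add: inst_append inst_sym_blocks)
        qed
        then have "has_space ?K 1 (L + r) A" using t unfolding has_space_def by auto
        then show False using A(2) by blast
      qed
    qed
    moreover have "cnt ?K N B = (\<Sum>y\<in>cube ?K N. of_bool (Q (Y1 @ y # Y2) z))"
      unfolding cnt_def Q_def dec by (simp only: B_def low mem_Collect_eq)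
    moreover have "(\<forall>i<k. y \<in> C i) \<longleftrightarrow> P e (Y1 @ y # Y2) z" for y
      unfolding P_def dec by (simp only: C_def mem_Collect_eq)
    ultimately show ?thesis by simp
  qed
  have tot_eq: "(\<Sum>Y\<in>W. \<Sum>z\<in>cube ?K r. h Y z) = (\<Sum>Y1\<in>words (cube ?K N) b. \<Sum>Y2\<in>words (cube ?K N) d.
      \<Sum>z\<in>cube ?K r. \<Sum>y\<in>cube ?K N. h (Y1 @ y # Y2) z)" for h :: "nat list list \<Rightarrow> nat list \<Rightarrow> real"
    unfolding W_def mbd sum_words_middle by (intro sum.cong refl sum.swap)
  have ec: "inst e [k] \<in> cube ?K m" using ik[of e k] eT by (simp add: tmpl_def)
  have "(\<delta> - \<kappa>) * X = (\<Sum>Y\<in>W. (\<delta> - \<kappa>) * real ?K ^ r)" by (simp add: X_def)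
  also have "\<dots> \<le> (\<Sum>Y\<in>W. cnt ?K r {z. blocks k (inst e [k]) Y @ z \<in> A})"
    by (intro sum_mono slice) (use blocks_cube[OF ec] in \<open>simp add: L_def W_def\<close>)
  also have "\<dots> = (\<Sum>Y\<in>W. \<Sum>z\<in>cube ?K r. of_bool (Q Y z))"
    unfolding cnt_def Q_def mem_Collect_eq ..
  also have "\<dots> \<le> (\<Sum>Y\<in>W. \<Sum>z\<in>cube ?K r. \<rho> * (1 - of_bool (P e Y z)) + \<kappa>)"
    unfolding tot_eq by (intro sum_mono key)
  also have "\<dots> = \<rho> * (X - (\<Sum>Y\<in>W. \<Sum>z\<in>cube ?K r. of_bool (P e Y z))) + \<kappa> * X"
    unfolding sum.distrib sum_distrib_left[symmetric] sum_subtractf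
    by (simp add: X_def card_cube mult_ac del: of_nat_Suc)
  also have "\<dots> \<le> \<rho> * (X - \<theta> * X) + \<kappa> * X"
    using e(2) \<delta> \<kappa> by (intro add_mono mult_left_mono) (auto simp: \<rho>_def)
  finally have "(\<delta> - \<kappa>) * X \<le> (\<rho> * (1 - \<theta>) + \<kappa>) * X" by (simp add: algebra_simps)
  then have "\<delta> - \<kappa> \<le> \<rho> * (1 - \<theta>) + \<kappa>" using X by simp
  then have "\<delta> * \<theta> + \<kappa> * \<theta> \<le> 3 * \<kappa>" by (simp add: \<rho>_def algebra_simps)
  moreover have "0 < \<kappa> * \<theta>" using \<kappa> \<theta> by simp
  moreover have "\<delta> * \<theta> = 4 * \<kappa>" by (simp add: \<kappa>_def)
  ultimately show False using \<kappa> by linarith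
qed

lemma dhj_1: "dhj 1"
proof -
  have "has_space 1 1 1 A" if "0 < \<delta>" "\<delta> * real 1 ^ 1 \<le> cnt 1 1 A" for \<delta> A
  proof -
    have cube: "cube 1 1 = {[0]}" by (auto simp: words_def length_Suc_conv)
    then have "[0] \<in> A" using that by (cases "[0] \<in> A") (auto simp: cnt_def simp del: One_nat_def)
    then have "inst [Var 0] [0] \<in> A" by (simp add: inst_def)
    moreover have "[Var 0] \<in> tmpl 1 1 1" by (auto simp: tmpl_def)
    ultimately show ?thesis unfolding has_space_def cube by blast
  qed
  then show ?thesis unfolding dhj_def by blast
qed

lemma density_hales_jewett: "0 < k \<Longrightarrow> dhj k"
proof (induction k rule: nat_induct_non_zero)
  case 1
  show ?case by (rule dhj_1)
next
  case (Suc k)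
  then show ?case by (intro dhj_Suc)
qed

subsection \<open>Lines in the grid and in space\<close>

definition active :: "nat \<Rightarrow> sym list \<Rightarrow> nat set" where
  "active n t = {j. j < n \<and> t ! j = Var 0}"

text \<open>The letter is extended to a real parameter, which turns a combinatorial line into a
  straight one. Only coordinates below \<open>n\<close> carry meaning, hence the range
  \<open>j < n\<close> in all comparisons.\<close>

definition pt :: "sym list \<Rightarrow> real \<Rightarrow> nat \<Rightarrow> real" where
  "pt t s j = (case t ! j of Lit c \<Rightarrow> real c | Var _ \<Rightarrow> s)"

lemma tmpl1_nth:
  assumes "t \<in> tmpl k 1 n" "j < n"
  shows "t ! j = Var 0 \<or> (\<exists>c<k. t ! j = Lit c)"
proof -
  have mem: "t ! j \<in> set t" using assms by (simp add: tmpl_def)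
  show ?thesis
  proof (cases "t ! j")
    case (Lit c)
    then show ?thesis using mem assms(1) by (auto simp: tmpl_def)
  next
    case (Var i)
    then have "i < 1" using mem assms(1) by (simp add: tmpl_def)
    then show ?thesis using Var by simp
  qed
qed

lemma active_nonempty:
  assumes "t \<in> tmpl k 1 n"
  obtains j where "j \<in> active n t"
proof -
  have "Var 0 \<in> set t" using assms by (simp add: tmpl_def)
  then obtain j where "j < length t" "t ! j = Var 0" by (auto simp: in_set_conv_nth)
  then show thesis using that assms by (simp add: active_def tmpl_def)
qed

lemma pt_active: "j \<in> active n t \<Longrightarrow> pt t s j = s"
  by (simp add: pt_def active_def)

lemma pt_inactive:
  assumes "t \<in> tmpl k 1 n" "j < n" "j \<notin> active n t"
  obtains c where "c < k" "t ! j = Lit c" "\<And>s. pt t s j = real c"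
  using tmpl1_nth[OF assms(1,2)] assms(2,3) by (auto simp: active_def pt_def)

lemma pt_inst:
  assumes "t \<in> tmpl k 1 n" "j < n"
  shows "real (inst t [c] ! j) = pt t (real c) j"
proof -
  have "j < length t" using assms by (simp add: tmpl_def)
  then show ?thesis using tmpl1_nth[OF assms] by (auto simp: inst_def pt_def)
qed

lemma inst_eq_iff_pt:
  assumes "t \<in> tmpl k 1 n" "t' \<in> tmpl k 1 n"
  shows "inst t [c] = inst t' [c'] \<longleftrightarrow> (\<forall>j<n. pt t (real c) j = pt t' (real c') j)"
proof
  assume eq: "inst t [c] = inst t' [c']"
  show "\<forall>j<n. pt t (real c) j = pt t' (real c') j"
    using pt_inst[OF assms(1), of _ c] pt_inst[OF assms(2), of _ c'] unfolding eq by simp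
next
  assume eq: "\<forall>j<n. pt t (real c) j = pt t' (real c') j"
  show "inst t [c] = inst t' [c']"
  proof (rule nth_equalityI)
    show "length (inst t [c]) = length (inst t' [c'])" using assms by (simp add: inst_def tmpl_def)
    fix j assume "j < length (inst t [c])"
    then have "j < n" using assms by (simp add: inst_def tmpl_def)
    then show "inst t [c] ! j = inst t' [c'] ! j"
      using eq pt_inst[OF assms(1), of j c] pt_inst[OF assms(2), of j c'] by simp
  qed
qed

lemma parallel_lines_eq:
  assumes t: "t \<in> tmpl k 1 n" and t': "t' \<in> tmpl k 1 n"
    and act: "active n t = active n t'" and eq: "\<forall>j<n. pt t s j = pt t' s' j"
  shows "t = t'"
proof (rule nth_equalityI)
  show "length t = length t'" using t t' by (simp add: tmpl_def)
  fix j assume "j < length t"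
  then have j: "j < n" using t by (simp add: tmpl_def)
  show "t ! j = t' ! j"
  proof (cases "j \<in> active n t")
    case True
    moreover have "j \<in> active n t'" using True act by simp
    ultimately show ?thesis by (simp add: active_def)
  next
    case False
    have False': "j \<notin> active n t'" using False act by simp
    obtain c where c: "t ! j = Lit c" "pt t s j = real c" using pt_inactive[OF t j False] by metis
    obtain c' where c': "t' ! j = Lit c'" "pt t' s' j = real c'" using pt_inactive[OF t' j False'] by metis
    have "real c = real c'" using eq j c(2) c'(2) by simp
    then show ?thesis using c(1) c'(1) by simp
  qed
qed

text \<open>At coordinate \<open>j\<close> the common point has the value \<open>s\<close> on
  \<open>t\<close> and a letter on \<open>t'\<close>, so \<open>s\<close> is a letter. An active
  coordinate of \<open>t'\<close> then shows the same for \<open>s'\<close>: on \<open>t\<close> it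
  has the value \<open>s\<close> or a fixed letter.\<close>

lemma line_crossing_letters:
  assumes t: "t \<in> tmpl k 1 n" and t': "t' \<in> tmpl k 1 n"
    and j: "j \<in> active n t" "j \<notin> active n t'" and eq: "\<forall>j<n. pt t s j = pt t' s' j"
  shows "\<exists>c<k. \<exists>c'<k. s = real c \<and> s' = real c'"
proof -
  have jn: "j < n" using j(1) by (simp add: active_def)
  obtain c where c: "c < k" "pt t' s' j = real c" using pt_inactive[OF t' jn j(2)] by metis
  have s: "s = real c" using eq[rule_format, OF jn] c(2) pt_active[OF j(1), of s] by simp
  obtain i where i: "i \<in> active n t'" by (rule active_nonempty[OF t'])
  have "i < n" using i by (simp add: active_def)
  have "\<exists>c'<k. s' = real c'"
  proof (cases "i \<in> active n t")
    case True
    then have "s' = s" using eq \<open>i < n\<close> pt_active[OF i] pt_active[OF True] by metis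
    then show ?thesis using s c(1) by blast
  next
    case False
    obtain c' where "c' < k" "pt t s i = real c'" using pt_inactive[OF t \<open>i < n\<close> False] by metis
    then show ?thesis using eq \<open>i < n\<close> pt_active[OF i] by metis
  qed
  then show ?thesis using s c(1) by blast
qed

lemma line_crossing:
  assumes t: "t \<in> tmpl k 1 n" and t': "t' \<in> tmpl k 1 n" and "t \<noteq> t'"
    and eq: "\<forall>j<n. pt t s j = pt t' s' j"
  shows "\<exists>c<k. \<exists>c'<k. inst t [c] = inst t' [c']"
proof -
  have "active n t \<noteq> active n t'" using parallel_lines_eq[OF t t' _ eq] \<open>t \<noteq> t'\<close> by blast
  then consider j where "j \<in> active n t" "j \<notin> active n t'" | j where "j \<in> active n t'" "j \<notin> active n t"
    by blast
  then have "\<exists>c<k. \<exists>c'<k. s = real c \<and> s' = real c'"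
  proof cases
    case 1
    then show ?thesis using line_crossing_letters[OF t t' _ _ eq] by blast
  next
    case 2
    have "\<forall>j<n. pt t' s' j = pt t s j" using eq by simp
    then show ?thesis using line_crossing_letters[OF t' t 2] by blast
  qed
  then obtain c c' where "c < k" "c' < k" "s = real c" "s' = real c'" by blast
  then show ?thesis using eq inst_eq_iff_pt[OF t t', of c c'] by blast
qed

text \<open>Going around the triangle, \<open>(a3 - b3) 1_U = (a1 - c1) 1_S - (b2 - c2) 1_T\<close>
  for the three active sets, where \<open>a1 - c1\<close> and \<open>b2 - c2\<close> are nonzero
  because \<open>t3\<close> misses the common point. As \<open>S \<noteq> T\<close>,
  \<open>a3 - b3\<close> is nonzero and equals \<open>a1 - c1\<close> or \<open>-(b2 - c2)\<close>;
  it thus differs from the value \<open>(a1 - c1) - (b2 - c2)\<close> on the intersection of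
  \<open>S\<close> and \<open>T\<close>, so that \<open>U\<close> contains no coordinate of
  it.\<close>

lemma triangle_direction:
  assumes t1: "t1 \<in> tmpl k 1 n" and t2: "t2 \<in> tmpl k 1 n" and t3: "t3 \<in> tmpl k 1 n" and "t1 \<noteq> t2"
    and w: "inst t1 [c1] = inst t2 [c2]"
    and a: "inst t1 [a1] = inst t3 [a3]" and b: "inst t2 [b2] = inst t3 [b3]"
    and no: "inst t3 [a3] \<noteq> inst t1 [c1]" "inst t3 [b3] \<noteq> inst t1 [c1]"
  shows "active n t3 = (active n t1 - active n t2) \<union> (active n t2 - active n t1)"
proof -
  define S T U where "S = active n t1" and "T = active n t2" and "U = active n t3"
  have ne: "S \<noteq> T"
    using parallel_lines_eq[OF t1 t2, of c1 c2] w \<open>t1 \<noteq> t2\<close> inst_eq_iff_pt[OF t1 t2, of c1 c2]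
    by (auto simp: S_def T_def)
  have "a1 \<noteq> c1" "b2 \<noteq> c2" using a b no w by auto
  have W: "pt t1 c1 j = pt t2 c2 j" if "j < n" for j using w inst_eq_iff_pt[OF t1 t2] that by blast
  have A: "pt t1 a1 j = pt t3 a3 j" if "j < n" for j using a inst_eq_iff_pt[OF t1 t3] that by blast
  have B: "pt t2 b2 j = pt t3 b3 j" if "j < n" for j using b inst_eq_iff_pt[OF t2 t3] that by blast
  have act: "pt t1 x j = x" if "j \<in> S" for x j using that pt_active unfolding S_def by blast
  have act2: "pt t2 x j = x" if "j \<in> T" for x j using that pt_active unfolding T_def by blast
  have act3: "pt t3 x j = x" if "j \<in> U" for x j using that pt_active unfolding U_def by blast
  have ina: "pt t1 x j = pt t1 y j" if "j \<notin> S" "j < n" for x y j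
    using pt_inactive[OF t1 that(2)] that(1) unfolding S_def by metis
  have ina2: "pt t2 x j = pt t2 y j" if "j \<notin> T" "j < n" for x y j
    using pt_inactive[OF t2 that(2)] that(1) unfolding T_def by metis
  have ina3: "pt t3 x j = pt t3 y j" if "j \<notin> U" "j < n" for x y j
    using pt_inactive[OF t3 that(2)] that(1) unfolding U_def by metis
  have Sn: "j < n" if "j \<in> S \<union> T \<union> U" for j using that by (auto simp: S_def T_def U_def active_def)
  have ST: "j \<in> U" if "j \<in> S" "j \<notin> T" for j
  proof (rule ccontr)
    assume "j \<notin> U"
    have "j < n" using Sn that by blast
    then have "real a1 = real c1"
      using A B W act[OF that(1)] ina2[OF that(2)] ina3[OF \<open>j \<notin> U\<close>] by metis
    then show False using \<open>a1 \<noteq> c1\<close> by simp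
  qed
  have TS: "j \<in> U" if "j \<in> T" "j \<notin> S" for j
  proof (rule ccontr)
    assume "j \<notin> U"
    have "j < n" using Sn that by blast
    then have "real b2 = real c2"
      using A B W act2[OF that(1)] ina[OF that(2)] ina3[OF \<open>j \<notin> U\<close>] by metis
    then show False using \<open>b2 \<noteq> c2\<close> by simp
  qed
  have "a3 \<noteq> b3"
  proof
    assume "a3 = b3"
    obtain j where "j \<in> S \<and> j \<notin> T \<or> j \<in> T \<and> j \<notin> S" using ne by blast
    then show False
    proof
      assume j: "j \<in> S \<and> j \<notin> T"
      then have "j < n" using Sn by blast
      then have "real a1 = real c1" using A B W act ina2 j \<open>a3 = b3\<close> by metis
      then show False using \<open>a1 \<noteq> c1\<close> by simp
    next
      assume j: "j \<in> T \<and> j \<notin> S"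
      then have "j < n" using Sn by blast
      then have "real b2 = real c2" using A B W act2 ina j \<open>a3 = b3\<close> by metis
      then show False using \<open>b2 \<noteq> c2\<close> by simp
    qed
  qed
  have none: "j \<notin> U" if "j \<notin> S" "j \<notin> T" for j
  proof
    assume "j \<in> U"
    then have "j < n" using Sn by blast
    then have "real a3 = real b3" using A B W act3[OF \<open>j \<in> U\<close>] ina[OF that(1)] ina2[OF that(2)] by metis
    then show False using \<open>a3 \<noteq> b3\<close> by simp
  qed
  have both: "j \<notin> U" if "j \<in> S" "j \<in> T" for j
  proof
    assume "j \<in> U"
    then have "j < n" using Sn by blast
    then have j: "real a1 = real a3" "real b2 = real b3" "real c1 = real c2"
      using A B W act[OF that(1)] act2[OF that(2)] act3[OF \<open>j \<in> U\<close>] by metis+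
    obtain i where "i \<in> S \<and> i \<notin> T \<or> i \<in> T \<and> i \<notin> S" using ne by blast
    then show False
    proof
      assume i: "i \<in> S \<and> i \<notin> T"
      then have "i < n" "i \<in> U" using Sn ST by auto
      then have "real b3 = real c1" using B W act act3 ina2 i by metis
      then show False using j \<open>b2 \<noteq> c2\<close> by simp
    next
      assume i: "i \<in> T \<and> i \<notin> S"
      then have "i < n" "i \<in> U" using Sn TS by auto
      then have "real a3 = real c2" using A W act2 act3 ina i by metis
      then show False using j \<open>a1 \<noteq> c1\<close> by simp
    qed
  qed
  show ?thesis using ST TS none both unfolding S_def T_def U_def by blast
qed

text \<open>
  A line missing the common point of two others has a determined direction, and parallel lines do
  not meet, so at most one line misses that point.
\<close>
lemma meeting_lines_hit:
  assumes S: "S \<subseteq> tmpl k 1 n" and k: "0 < k"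
    and meet: "\<And>t t'. t \<in> S \<Longrightarrow> t' \<in> S \<Longrightarrow> t \<noteq> t' \<Longrightarrow> \<exists>c<k. \<exists>c'<k. inst t [c] = inst t' [c']"
  shows "\<exists>H. finite H \<and> card H \<le> 2 \<and> (\<forall>t\<in>S. \<exists>c<k. inst t [c] \<in> H)"
proof (cases "\<exists>t1\<in>S. \<exists>t2\<in>S. t1 \<noteq> t2")
  case False
  show ?thesis
  proof (cases "S = {}")
    case True
    then show ?thesis by (intro exI[of _ "{}"]) simp
  next
    case nonempty: False
    then obtain t where "t \<in> S" by blast
    then have "\<forall>t'\<in>S. t' = t" using False by blast
    then show ?thesis using k by (intro exI[of _ "{inst t [0]}"]) auto
  qed
next
  case True
  then obtain t1 t2 where t12: "t1 \<in> S" "t2 \<in> S" "t1 \<noteq> t2" by blast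
  obtain c1 c2 where c: "c1 < k" "c2 < k" "inst t1 [c1] = inst t2 [c2]" using meet[OF t12] by blast
  define w where "w = inst t1 [c1]"
  define miss where "miss t \<longleftrightarrow> t \<in> S \<and> (\<forall>c<k. inst t [c] \<noteq> w)" for t
  have dir: "active n t = (active n t1 - active n t2) \<union> (active n t2 - active n t1)" if t: "miss t" for t
  proof -
    have "t \<noteq> t1" "t \<noteq> t2" using t c unfolding miss_def w_def by auto
    then obtain a1 a3 b2 b3 where "a3 < k" "b3 < k"
      "inst t1 [a1] = inst t [a3]" "inst t2 [b2] = inst t [b3]"
      using meet[OF t12(1), of t] meet[OF t12(2), of t] t unfolding miss_def by metis
    moreover have "inst t [a3] \<noteq> inst t1 [c1]" "inst t [b3] \<noteq> inst t1 [c1]"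
      using t calculation(1,2) unfolding miss_def w_def by blast+
    ultimately show ?thesis
      using triangle_direction[of t1 k n t2 t, OF _ _ _ t12(3) c(3)] S t12 t unfolding miss_def by blast
  qed
  have uniq: "t = t'" if "miss t" "miss t'" for t t'
  proof (rule ccontr)
    assume "t \<noteq> t'"
    have tS: "t \<in> S" "t' \<in> S" using that by (auto simp: miss_def)
    then obtain c c' where "inst t [c] = inst t' [c']" using meet[OF tS \<open>t \<noteq> t'\<close>] by blast
    moreover have tt: "t \<in> tmpl k 1 n" "t' \<in> tmpl k 1 n" using tS S by auto
    ultimately have "\<forall>j<n. pt t (real c) j = pt t' (real c') j" using inst_eq_iff_pt by blast
    moreover have "active n t = active n t'" using dir[OF that(1)] dir[OF that(2)] by simp
    ultimately show False using parallel_lines_eq[OF tt] \<open>t \<noteq> t'\<close> by blast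
  qed
  show ?thesis
  proof (cases "\<exists>t. miss t")
    case True
    then obtain t3 where t3: "miss t3" by blast
    \<comment> \<open>Only \<open>t3\<close> misses \<open>w\<close>, so any of its grid points,
      here the one with letter 0, serves as the second point.\<close>
    have "\<exists>c<k. inst t [c] \<in> {w, inst t3 [0]}" if "t \<in> S" for t
    proof (cases "miss t")
      case True
      then have "t = t3" using uniq t3 by blast
      then show ?thesis using k by blast
    next
      case False
      then show ?thesis using that unfolding miss_def by blast
    qed
    moreover have "card {w, inst t3 [0]} \<le> 2" by (simp add: card_insert_le_m1)
    ultimately show ?thesis by (intro exI[of _ "{w, inst t3 [0]}"]) simp
  next
    case False
    then have "\<forall>t\<in>S. \<exists>c<k. inst t [c] \<in> {w}" unfolding miss_def by blast
    then show ?thesis by (intro exI[of _ "{w}"]) simp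
  qed
qed

text \<open>With \<open>f j = x ^ j\<close> the sum is a polynomial in \<open>x\<close> with
  coefficients \<open>z j\<close>. Finitely many nonzero polynomials have finitely many roots, and
  any other \<open>x\<close> will do.\<close>

lemma generic_functional:
  fixes Z :: "(nat \<Rightarrow> real) set"
  assumes "finite Z"
  shows "\<exists>f. \<forall>z\<in>Z. (\<Sum>j<n. f j * z j) = 0 \<longrightarrow> (\<forall>j<n. z j = 0)"
proof -
  define Z' where "Z' = {z\<in>Z. \<exists>j<n. z j \<noteq> 0}"
  have "finite {x. (\<Sum>j<n. x ^ j * z j) = 0}" if z: "z \<in> Z'" for z
  proof -
    obtain i where i: "i < n" "z i \<noteq> 0" using z by (auto simp: Z'_def)
    then have "{..n - 1} = {..<n}" by auto
    moreover have "finite {x. (\<Sum>j\<le>n - 1. z j * x ^ j) = 0}"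
      by (subst polyfun_finite_roots) (use i in \<open>auto intro!: exI[of _ i]\<close>)
    ultimately show ?thesis by (simp add: mult.commute)
  qed
  moreover have "finite Z'" using assms by (simp add: Z'_def)
  ultimately have "finite (\<Union>z\<in>Z'. {x. (\<Sum>j<n. x ^ j * z j) = 0})" by blast
  then obtain x where x: "x \<notin> (\<Union>z\<in>Z'. {x. (\<Sum>j<n. x ^ j * z j) = 0})"
    using ex_new_if_finite infinite_UNIV_char_0 by blast
  then show ?thesis by (intro exI[of _ "\<lambda>j. x ^ j"]) (auto simp: Z'_def)
qed

text \<open>
  A common point of the images of two lines is a common zero \<open>q + s a - s' a'\<close> of three
  functionals on \<open>\<real>\<^sup>n\<close>. The first one expresses \<open>s\<close> through
  \<open>s'\<close>, the second one determines \<open>s'\<close>, and the third one tests the resulting vector.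
\<close>
lemma generic_projection:
  shows "\<exists>v :: nat \<Rightarrow> real^3. \<forall>t\<in>tmpl k 1 n. \<forall>t'\<in>tmpl k 1 n. \<forall>s s'.
    (\<Sum>j<n. pt t s j *\<^sub>R v j) = (\<Sum>j<n. pt t' s' j *\<^sub>R v j) \<longrightarrow> (\<forall>j<n. pt t s j = pt t' s' j)"
proof -
  define I where "I = tmpl k 1 n \<times> tmpl k 1 n"
  have finI: "finite I" by (simp add: I_def)
  define dir where "dir t j = pt t 1 j - pt t 0 j" for t j
  have pt: "pt t s j = pt t 0 j + s * dir t j" for t s j
    by (cases "t ! j") (auto simp: pt_def dir_def)
  \<comment> \<open>The first functional is the coordinate sum. It is positive on directions, which
    are nonzero 0/1 vectors, so \<open>s\<close> can always be eliminated.\<close>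
  define A where "A t = (\<Sum>j<n. dir t j)" for t
  have A: "0 < A t" if t: "t \<in> tmpl k 1 n" for t
  proof -
    obtain i where i: "i \<in> active n t" by (rule active_nonempty[OF t])
    have "0 \<le> dir t j" for j by (cases "t ! j") (auto simp: pt_def dir_def)
    moreover have "0 < dir t i" "i < n" using i by (auto simp: dir_def pt_active active_def)
    ultimately show ?thesis unfolding A_def by (intro sum_pos2[of _ i]) auto
  qed
  define q where "q p j = pt (fst p) 0 j - pt (snd p) 0 j" for p j
  define Q where "Q p = (\<Sum>j<n. q p j)" for p
  define q' where "q' p j = q p j - Q p / A (fst p) * dir (fst p) j" for p j
  define b' where "b' p j = A (snd p) / A (fst p) * dir (fst p) j - dir (snd p) j" for p j
  obtain f where f: "\<And>z. z \<in> q' ` I \<union> b' ` I \<Longrightarrow> (\<Sum>j<n. f j * z j) = 0 \<Longrightarrow> \<forall>j<n. z j = 0"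
    using generic_functional[of "q' ` I \<union> b' ` I" n] finI by auto
  define \<phi> where "\<phi> z = (\<Sum>j<n. f j * z j)" for z
  \<comment> \<open>The case \<open>\<phi> (b' p) = 0\<close> is settled separately: by the choice
    of \<open>f\<close>, \<open>b' p\<close> then vanishes below \<open>n\<close>, and a common
    point forces the same for \<open>q' p\<close>.\<close>
  define q'' where "q'' p j = q' p j - \<phi> (q' p) / \<phi> (b' p) * b' p j" for p j
  obtain g where g: "\<And>z. z \<in> q'' ` I \<Longrightarrow> (\<Sum>j<n. g j * z j) = 0 \<Longrightarrow> \<forall>j<n. z j = 0"
    using generic_functional[of "q'' ` I" n] finI by auto
  define v :: "nat \<Rightarrow> real^3" where "v j = vector [1, f j, g j]" for j
  have "\<forall>j<n. pt t s j = pt t' s' j"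
    if t: "t \<in> tmpl k 1 n" "t' \<in> tmpl k 1 n"
      and eq: "(\<Sum>j<n. pt t s j *\<^sub>R v j) = (\<Sum>j<n. pt t' s' j *\<^sub>R v j)" for t t' s s'
  proof -
    define p where "p = (t, t')"
    have p: "p \<in> I" using t by (simp add: p_def I_def)
    define x where "x j = pt t s j - pt t' s' j" for j
    have x: "x j = q p j + s * dir t j - s' * dir t' j" for j
      unfolding x_def q_def p_def by (simp add: pt[of t s] pt[of t' s'])
    have "(\<Sum>j<n. x j *\<^sub>R v j) = 0" using eq by (simp add: x_def scaleR_diff_left sum_subtractf)
    then have "(\<Sum>j<n. x j *\<^sub>R v j) $ i = 0" for i by simp
    then have comp: "(\<Sum>j<n. x j * (v j $ i)) = 0" for i by (simp add: sum_component)
    have x1: "(\<Sum>j<n. x j) = 0" using comp[of 1] by (simp add: v_def vector_def)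
    have x2: "(\<Sum>j<n. f j * x j) = 0" using comp[of 2] by (simp add: v_def vector_def mult.commute)
    have x3: "(\<Sum>j<n. g j * x j) = 0" using comp[of 3] by (simp add: v_def vector_def mult.commute)
    have "Q p + s * A t - s' * A t' = 0"
      using x1 unfolding x by (simp add: sum.distrib sum_subtractf sum_distrib_left Q_def A_def)
    then have s: "s = s' * (A t' / A t) - Q p / A t" using A[OF t(1)] by (simp add: field_simps)
    have x': "x j = q' p j + s' * b' p j" for j
      unfolding x s q'_def b'_def p_def by (simp add: algebra_simps)
    have "\<phi> (q' p) + s' * \<phi> (b' p) = 0"
      using x2 unfolding x' \<phi>_def by (simp add: sum.distrib sum_distrib_left algebra_simps)
    have "\<forall>j<n. x j = 0"
    proof (cases "\<phi> (b' p) = 0")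
      case True
      then have "\<forall>j<n. b' p j = 0" using f p unfolding \<phi>_def by blast
      moreover have "\<forall>j<n. q' p j = 0"
        using f[of "q' p"] p True \<open>\<phi> (q' p) + s' * \<phi> (b' p) = 0\<close> unfolding \<phi>_def by simp
      ultimately show ?thesis by (simp add: x')
    next
      case False
      then have "s' = - \<phi> (q' p) / \<phi> (b' p)"
        using \<open>\<phi> (q' p) + s' * \<phi> (b' p) = 0\<close> by (simp add: field_simps)
      then have "x j = q'' p j" for j unfolding x' q''_def by simp
      then have "x = q'' p" by blast
      then show ?thesis using g[of x] p x3 by blast
    qed
    then show ?thesis by (simp add: x_def)
  qed
  then show ?thesis by blast
qed

subsection \<open>Chromatic and clique numbers\<close>

lemma disjointness_edges_iff:
  assumes "L \<in> F" "M \<in> F"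
  shows "{L, M} \<in> disjointness_edges F \<longleftrightarrow> L \<noteq> M \<and> disjnt L M"
proof
  assume "{L, M} \<in> disjointness_edges F"
  then obtain L' M' where "{L, M} = {L', M'}" "L' \<noteq> M'" "disjnt L' M'"
    unfolding disjointness_edges_def mem_Collect_eq by (elim exE conjE) (rule that)
  then show "L \<noteq> M \<and> disjnt L M" using disjnt_sym[of L' M'] unfolding doubleton_eq_iff by auto
next
  assume "L \<noteq> M \<and> disjnt L M"
  then show "{L, M} \<in> disjointness_edges F"
    unfolding disjointness_edges_def mem_Collect_eq
    by (intro exI[of _ L] exI[of _ M]) (use assms in simp)
qed

lemma chromatic_number_le: "proper_colouring V E n c \<Longrightarrow> chromatic_number V E \<le> n"
  unfolding chromatic_number_def by (rule Least_le) blast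

lemma chromatic_number_colouring:
  assumes "finite F"
  obtains c where "proper_colouring F (disjointness_edges F) (chromatic_number F (disjointness_edges F)) c"
proof -
  obtain f :: "'a set \<Rightarrow> nat" and n where f: "f ` F = {i. i < n}" "inj_on f F"
    using finite_imp_inj_to_nat_seg[OF assms] by blast
  have "proper_colouring F (disjointness_edges F) n f"
    using f unfolding proper_colouring_def
    by (auto simp: disjointness_edges_iff dest: inj_onD)
  then have "\<exists>n c. proper_colouring F (disjointness_edges F) n c" by blast
  from LeastI_ex[OF this] show thesis using that unfolding chromatic_number_def by blast
qed

lemma finite_clique_cards:
  assumes "finite V"
  shows "finite {card K | K. K \<subseteq> V \<and> clique K E}"
proof -
  have "{card K | K. K \<subseteq> V \<and> clique K E} \<subseteq> card ` Pow V" by auto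
  then show ?thesis by (rule finite_subset) (use assms in simp)
qed

lemma card_le_clique_number:
  assumes "finite V" "K \<subseteq> V" "clique K E"
  shows "card K \<le> clique_number V E"
  unfolding clique_number_def by (rule Max_ge[OF finite_clique_cards]) (use assms in auto)

lemma clique_number_obtain:
  assumes "finite V"
  obtains K where "K \<subseteq> V" "clique K E" "card K = clique_number V E"
proof -
  have "clique {} E" by (simp add: clique_def)
  then have "{card K | K. K \<subseteq> V \<and> clique K E} \<noteq> {}" by blast
  from Max_in[OF finite_clique_cards[OF assms] this] show thesis
    using that unfolding clique_number_def by auto
qed

lemma clique_disjnt:
  assumes "clique K (disjointness_edges F)" "K \<subseteq> F" "L \<in> K" "M \<in> K" "L \<noteq> M"
  shows "disjnt L M"
proof -
  have "{L, M} \<in> disjointness_edges F" using assms(1,3,4,5) unfolding clique_def by blast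
  moreover have "L \<in> F" "M \<in> F" using assms(2,3,4) by auto
  ultimately show ?thesis by (simp add: disjointness_edges_iff)
qed

subsection \<open>Affine lines\<close>

lemma affine_line_range:
  fixes p d :: "'v::euclidean_space"
  assumes "d \<noteq> 0"
  shows "affine_line (range (\<lambda>s. p + s *\<^sub>R d))"
proof -
  have "range (\<lambda>s. p + s *\<^sub>R d) = affine hull {p, p + d}"
  proof
    show "range (\<lambda>s. p + s *\<^sub>R d) \<subseteq> affine hull {p, p + d}"
    proof
      fix x assume "x \<in> range (\<lambda>s. p + s *\<^sub>R d)"
      then obtain s where "x = (1 - s) *\<^sub>R p + s *\<^sub>R (p + d)" by (auto simp: algebra_simps)
      then show "x \<in> affine hull {p, p + d}"
        unfolding affine_hull_2 by (intro CollectI exI[of _ "1 - s"] exI[of _ s]) simp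
    qed
    show "affine hull {p, p + d} \<subseteq> range (\<lambda>s. p + s *\<^sub>R d)"
    proof
      fix x assume "x \<in> affine hull {p, p + d}"
      then obtain u v where uv: "x = u *\<^sub>R p + v *\<^sub>R (p + d)" "u + v = 1"
        unfolding affine_hull_2 by blast
      have "x = (u + v) *\<^sub>R p + v *\<^sub>R d"
        unfolding uv(1) scaleR_add_left scaleR_add_right by (simp only: add.assoc)
      then show "x \<in> range (\<lambda>s. p + s *\<^sub>R d)" using uv(2) by auto
    qed
  qed
  moreover have "aff_dim {p, p + d} = 1" using assms by (simp add: aff_dim_2)
  ultimately show ?thesis by (simp add: affine_line_def aff_dim_affine_hull)
qed

lemma affine_lines_ratio:
  fixes M :: real
  assumes "0 < M"
  shows "\<exists>F :: (real^3) set set. finite F \<and> (\<forall>L\<in>F. affine_line L) \<and>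
    real (chromatic_number F (disjointness_edges F)) / real (clique_number F (disjointness_edges F)) > M"
proof -
  \<comment> \<open>The factor 4 combines two points per colour class with the density
    \<open>1 / 2\<close>.\<close>
  define k where "k = nat \<lceil>4 * M\<rceil>"
  have k: "4 * M \<le> k" "0 < k" using assms by (auto simp: k_def)
  obtain n where n: "\<And>A. 1 / 2 * real k ^ n \<le> cnt k n A \<Longrightarrow> has_space k 1 n A"
    using density_hales_jewett[OF k(2)] unfolding dhj_def by (meson half_gt_zero zero_less_one)
  define T where "T = tmpl k 1 n"
  \<comment> \<open>The full cube is dense, so there is at least one line; this makes the clique
    number, the denominator of the ratio, positive.\<close>
  have "cnt k n UNIV = real k ^ n" by (simp add: cnt_def card_cube)
  then have "has_space k 1 n UNIV" by (intro n) simp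
  then obtain t0 where t0: "t0 \<in> T" unfolding has_space_def T_def by blast
  have finT: "finite T" by (simp add: T_def)
  obtain v :: "nat \<Rightarrow> real^3" where v: "\<And>t t' s s'. t \<in> T \<Longrightarrow> t' \<in> T \<Longrightarrow>
      (\<Sum>j<n. pt t s j *\<^sub>R v j) = (\<Sum>j<n. pt t' s' j *\<^sub>R v j) \<Longrightarrow> \<forall>j<n. pt t s j = pt t' s' j"
    using generic_projection[of k n] unfolding T_def by blast
  define pnt where "pnt t s = (\<Sum>j<n. pt t s j *\<^sub>R v j)" for t s
  define line where "line t = range (pnt t)" for t
  define F where "F = line ` T"
  have finF: "finite F" using finT by (simp add: F_def)
  let ?E = "disjointness_edges F"

  have "affine_line (line t)" if t: "t \<in> T" for t
  proof -
    define d where "d = pnt t 1 - pnt t 0"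
    have lin: "pt t s j = pt t 0 j + s * (pt t 1 j - pt t 0 j)" for s j
      by (cases "t ! j") (auto simp: pt_def)
    have lin': "pt t s j *\<^sub>R v j = pt t 0 j *\<^sub>R v j + s *\<^sub>R (pt t 1 j *\<^sub>R v j - pt t 0 j *\<^sub>R v j)" for s j
      by (subst lin) (simp add: algebra_simps)
    have lin'': "pnt t s = pnt t 0 + s *\<^sub>R d" for s
    proof -
      have "pnt t s = (\<Sum>j<n. pt t 0 j *\<^sub>R v j + s *\<^sub>R (pt t 1 j *\<^sub>R v j - pt t 0 j *\<^sub>R v j))"
        unfolding pnt_def by (intro sum.cong refl lin')
      then show ?thesis
        unfolding d_def pnt_def[of t 0] pnt_def[of t 1]
        by (simp only: sum.distrib scaleR_sum_right[symmetric] sum_subtractf)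
    qed
    have "line t = range (\<lambda>s. pnt t 0 + s *\<^sub>R d)"
      unfolding line_def by (rule image_cong[OF refl lin''])
    moreover have "d \<noteq> 0"
    proof
      assume "d = 0"
      then have eq: "\<forall>j<n. pt t 1 j = pt t 0 j" using v[OF t t, of 1 0] unfolding d_def pnt_def by simp
      obtain j where j: "j \<in> active n t" using active_nonempty t unfolding T_def by blast
      then have "j < n" by (simp add: active_def)
      then show False using eq pt_active[OF j, of 0] pt_active[OF j, of 1] by simp
    qed
    ultimately show ?thesis by (simp add: affine_line_range)
  qed
  then have aff: "\<forall>L\<in>F. affine_line L" by (auto simp: F_def)

  have word_meets: "\<not> disjnt (line t) (line t')"
    if t: "t \<in> T" "t' \<in> T" and eq: "inst t [c] = inst t' [c']" for t t' c c'
  proof -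
    have "\<forall>j<n. pt t (real c) j = pt t' (real c') j"
      using inst_eq_iff_pt[of t k n t' c c'] t eq unfolding T_def by blast
    then have "pnt t (real c) = pnt t' (real c')" unfolding pnt_def by simp
    then show ?thesis unfolding line_def disjnt_def by blast
  qed
  have meets_word: "\<exists>c<k. \<exists>c'<k. inst t [c] = inst t' [c']"
    if t: "t \<in> T" "t' \<in> T" "t \<noteq> t'" and nd: "\<not> disjnt (line t) (line t')" for t t'
  proof -
    obtain s s' where "pnt t s = pnt t' s'" using nd unfolding line_def disjnt_def by blast
    then have "\<forall>j<n. pt t s j = pt t' s' j" using v[OF t(1,2)] unfolding pnt_def by blast
    then show ?thesis using line_crossing[of t k n t' s s'] t unfolding T_def by blast
  qed

  have clique: "clique_number F ?E * k \<le> k ^ n"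
  proof -
    obtain K where K: "K \<subseteq> F" "clique K ?E" "card K = clique_number F ?E"
      using clique_number_obtain[OF finF] by blast
    define tm where "tm L = (SOME t. t \<in> T \<and> line t = L)" for L
    have tm: "tm L \<in> T" "line (tm L) = L" if "L \<in> K" for L
    proof -
      have "\<exists>t. t \<in> T \<and> line t = L" using that K(1) by (auto simp: F_def)
      from someI_ex[OF this] show "tm L \<in> T" "line (tm L) = L" unfolding tm_def by auto
    qed
    define W where "W L = (\<lambda>c. inst (tm L) [c]) ` {..<k}" for L
    have cardW: "card (W L) = k" if "L \<in> K" for L
    proof -
      have "inj_on (\<lambda>c. inst (tm L) [c]) {..<k}"
      proof (rule inj_onI)
        fix c c' assume "c \<in> {..<k}" "c' \<in> {..<k}" "inst (tm L) [c] = inst (tm L) [c']"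
        then have "[c] = [c']" using inst_inj[of "tm L" k 1 n "[c]" "{..<k}" "[c']" "{..<k}"] tm(1)[OF that]
          unfolding T_def by (simp add: words_def)
        then show "c = c'" by simp
      qed
      then show ?thesis by (simp add: W_def card_image)
    qed
    have "card (\<Union>L\<in>K. W L) = (\<Sum>L\<in>K. card (W L))"
    proof (rule card_UN_disjoint)
      show "finite K" using K(1) finF by (rule finite_subset)
      show "\<forall>L\<in>K. finite (W L)" by (simp add: W_def)
      show "\<forall>L\<in>K. \<forall>M\<in>K. L \<noteq> M \<longrightarrow> W L \<inter> W M = {}"
      proof (intro ballI impI)
        fix L L' assume L: "L \<in> K" "L' \<in> K" "L \<noteq> L'"
        then have "disjnt L L'" using clique_disjnt[OF K(2,1)] by blast
        then have "disjnt (line (tm L)) (line (tm L'))" using tm L by simp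
        then have "inst (tm L) [c] \<noteq> inst (tm L') [c']" for c c'
          using word_meets tm(1) L by blast
        then show "W L \<inter> W L' = {}" unfolding W_def by auto
      qed
    qed
    also have "\<dots> = card K * k" using cardW by simp
    finally have "card (\<Union>L\<in>K. W L) = card K * k" .
    moreover have "(\<Union>L\<in>K. W L) \<subseteq> cube k n"
    proof -
      have "inst (tm L) [c] \<in> cube k n" if "L \<in> K" "c < k" for L c
        using inst_cube[of "tm L" k 1 n "[c]"] tm(1)[OF that(1)] that(2) unfolding T_def by (simp add: words_def)
      then show ?thesis by (auto simp: W_def)
    qed
    then have "card (\<Union>L\<in>K. W L) \<le> card (cube k n)" by (intro card_mono) auto
    ultimately show ?thesis using K(3) by (simp add: card_cube)
  qed
  have clique_pos: "0 < clique_number F ?E"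
  proof -
    have "clique {line t0} ?E" by (simp add: clique_def)
    moreover have "{line t0} \<subseteq> F" using t0 by (simp add: F_def)
    ultimately show ?thesis using card_le_clique_number[OF finF, of "{line t0}" ?E] by simp
  qed

  have chromatic: "real k ^ n < 4 * real (chromatic_number F ?E)"
  proof -
    define q where "q = chromatic_number F ?E"
    obtain c where c: "proper_colouring F ?E q c"
      unfolding q_def by (rule chromatic_number_colouring[OF finF])
    define S where "S i = {t \<in> T. c (line t) = i}" for i
    have "\<exists>H. finite H \<and> card H \<le> 2 \<and> (\<forall>t\<in>S i. \<exists>c<k. inst t [c] \<in> H)" for i
    proof (rule meeting_lines_hit[OF _ k(2)])
      show "S i \<subseteq> tmpl k 1 n" by (auto simp: S_def T_def)
      fix t t' assume t: "t \<in> S i" "t' \<in> S i" "t \<noteq> t'"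
      then have tT: "t \<in> T" "t' \<in> T" and F: "line t \<in> F" "line t' \<in> F" by (auto simp: S_def F_def)
      have "c (line t) = c (line t')" using t by (simp add: S_def)
      then have "{line t, line t'} \<notin> ?E" using c F unfolding proper_colouring_def by blast
      \<comment> \<open>Templates of equal colour may also have coinciding lines; a line is nonempty
        and so meets itself, which covers this case.\<close>
      then have "line t = line t' \<or> \<not> disjnt (line t) (line t')"
        using disjointness_edges_iff[OF F] by blast
      moreover have "\<not> disjnt (line t) (line t)" unfolding line_def disjnt_def by blast
      ultimately have "\<not> disjnt (line t) (line t')" by metis
      then show "\<exists>c<k. \<exists>c'<k. inst t [c] = inst t' [c']" by (rule meets_word[OF tT t(3)])
    qed
    then obtain H where H: "\<And>i. finite (H i)" "\<And>i. card (H i) \<le> 2"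
      "\<And>i t. t \<in> S i \<Longrightarrow> \<exists>c<k. inst t [c] \<in> H i" by metis
    define U where "U = (\<Union>i<q. H i)"
    have finU: "finite U" using H(1) by (simp add: U_def)
    have "card U \<le> (\<Sum>i<q. card (H i))" unfolding U_def by (rule card_UN_le) simp
    also have "\<dots> \<le> (\<Sum>i<q. 2)" using H(2) by (intro sum_mono)
    finally have cardU: "card U \<le> 2 * q" by simp
    have "\<not> has_space k 1 n (- U)"
    proof
      assume "has_space k 1 n (- U)"
      then obtain t where t: "t \<in> T" "\<forall>w\<in>cube k 1. inst t w \<notin> U" unfolding has_space_def T_def by auto
      have "line t \<in> F" using t(1) by (simp add: F_def)
      then have "c (line t) < q" using c unfolding proper_colouring_def by auto
      moreover obtain a where "a < k" "inst t [a] \<in> H (c (line t))"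
        using H(3)[of t "c (line t)"] t(1) by (auto simp: S_def)
      ultimately have "inst t [a] \<in> U" "[a] \<in> cube k 1" by (auto simp: U_def words_def)
      then show False using t(2) by blast
    qed
    then have "cnt k n (- U) < 1 / 2 * real k ^ n" using n[of "- U"] by linarith
    moreover have "real k ^ n - card U \<le> cnt k n (- U)"
    proof -
      have "cnt k n (- U) = (\<Sum>w\<in>cube k n. 1 - of_bool (w \<in> U))"
        unfolding cnt_def by (intro sum.cong) auto
      also have "\<dots> = real k ^ n - (\<Sum>w\<in>cube k n. of_bool (w \<in> U))"
        unfolding sum_subtractf by (simp add: card_cube)
      finally have "cnt k n (- U) = real k ^ n - card (cube k n \<inter> U)" by simp
      moreover have "card (cube k n \<inter> U) \<le> card U" using finU by (intro card_mono) auto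
      ultimately show ?thesis by simp
    qed
    moreover have "real (card U) \<le> 2 * real q" using cardU by simp
    ultimately show ?thesis unfolding q_def by linarith
  qed
  have "M * real (clique_number F ?E) * 4 \<le> real (clique_number F ?E) * real k"
    using mult_right_mono[OF k(1), of "real (clique_number F ?E)"] by (simp add: mult_ac)
  also have "\<dots> \<le> real k ^ n" using clique by (metis of_nat_le_iff of_nat_mult of_nat_power)
  also note chromatic
  finally have "M * real (clique_number F ?E) < real (chromatic_number F ?E)" by simp
  then have "M < real (chromatic_number F ?E) / real (clique_number F ?E)"
    using clique_pos by (simp add: pos_less_divide_eq)
  then show ?thesis using finF aff by blast
qed

subsection \<open>Projective lines\<close>

text \<open>Without a common element the pairs lie in a triangle: some member \<open>{a, b}\<close>
  is accompanied by one avoiding \<open>a\<close>, necessarily \<open>{b, c}\<close>, and one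
  avoiding \<open>b\<close>, necessarily \<open>{a, c}\<close>. A pair that meets all three is
  contained in \<open>{a, b, c}\<close>.\<close>

lemma intersecting_pairs:
  assumes two: "\<And>e. e \<in> S \<Longrightarrow> card e = 2" and meet: "\<And>e f. e \<in> S \<Longrightarrow> f \<in> S \<Longrightarrow> e \<inter> f \<noteq> {}"
    and no: "\<nexists>v. \<forall>e\<in>S. v \<in> e"
  shows "finite S \<and> card S \<le> 3"
proof -
  obtain e where e: "e \<in> S" using no by blast
  then obtain a b where ab: "e = {a, b}" "a \<noteq> b" using two by (meson card_2_iff)
  obtain f where f: "f \<in> S" "a \<notin> f" using no by blast
  then have "b \<in> f" using meet[OF e f(1)] ab by auto
  then obtain c where c: "f = {b, c}" "b \<noteq> c" using two[OF f(1)] by (auto simp: card_2_iff)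
  obtain g where g: "g \<in> S" "b \<notin> g" using no by blast
  then have "a \<in> g" "c \<in> g" using meet[OF e g(1)] meet[OF f(1) g(1)] ab c by auto
  have "a \<noteq> c" using f c by auto
  have g': "g = {a, c}"
    using two[OF g(1)] \<open>a \<in> g\<close> \<open>c \<in> g\<close> \<open>a \<noteq> c\<close> by (auto simp: card_2_iff)
  have "h \<subseteq> {a, b, c}" if hS: "h \<in> S" for h
  proof -
    obtain x y where "h = {x, y}" using two[OF hS] by (auto simp: card_2_iff)
    then show ?thesis
      using meet[OF e hS] meet[OF f(1) hS] meet[OF g(1) hS] ab c g' \<open>a \<noteq> c\<close> by auto
  qed
  then have sub: "S \<subseteq> {h. h \<subseteq> {a, b, c} \<and> card h = 2}" using two by auto
  have "card {a, b, c} = 3" using ab c \<open>a \<noteq> c\<close> by auto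
  moreover have "(3::nat) choose 2 = 3" by (simp add: numeral_eq_Suc)
  ultimately have "card {h. h \<subseteq> {a, b, c} \<and> card h = 2} = 3" using n_subsets[of "{a, b, c}" 2] by simp
  moreover have "finite {h. h \<subseteq> {a, b, c} \<and> card h = 2}" by simp
  ultimately show ?thesis using finite_subset[OF sub] card_mono[OF _ sub] by simp
qed

text \<open>
  A colour class is a star or has at most three
  elements; deleting the centres of \<open>s\<close> stars leaves \<open>r \<ge> n - s\<close> points, and
  \<open>r (r - 1) / 2 \<ge> 3 (r - 2)\<close> because \<open>(r - 3) (r - 4) \<ge> 0\<close>.
\<close>
lemma kneser_pairs_colours:
  fixes col :: "nat set \<Rightarrow> nat"
  assumes col: "\<And>e. e \<subseteq> {..<n} \<Longrightarrow> card e = 2 \<Longrightarrow> col e < q"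
    and meet: "\<And>e f. e \<subseteq> {..<n} \<Longrightarrow> f \<subseteq> {..<n} \<Longrightarrow> card e = 2 \<Longrightarrow> card f = 2 \<Longrightarrow> col e = col f \<Longrightarrow> e \<inter> f \<noteq> {}"
  shows "n \<le> q + 2"
proof -
  define E where "E i = {e. e \<subseteq> {..<n} \<and> card e = 2 \<and> col e = i}" for i
  define stars where "stars = {i. i < q \<and> (\<exists>v. \<forall>e\<in>E i. v \<in> e)}"
  \<comment> \<open>An empty colour class counts as a star with an arbitrary centre. This is
    harmless, because at most one point per star is deleted.\<close>
  define centre where "centre i = (SOME v. \<forall>e\<in>E i. v \<in> e)" for i
  define R where "R = {..<n} - centre ` stars"
  have centre: "centre i \<in> e" if "i \<in> stars" "e \<in> E i" for i e
  proof -
    have "\<exists>v. \<forall>e\<in>E i. v \<in> e" using that(1) by (simp add: stars_def)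
    from someI_ex[OF this] show ?thesis using that(2) unfolding centre_def by blast
  qed
  have finS: "finite stars" by (simp add: stars_def)
  have sq: "stars \<subseteq> {..<q}" by (auto simp: stars_def)
  have small: "finite (E i) \<and> card (E i) \<le> 3" if "i < q" "i \<notin> stars" for i
    by (rule intersecting_pairs) (use that meet in \<open>auto simp: E_def stars_def\<close>)
  have "{e. e \<subseteq> R \<and> card e = 2} \<subseteq> (\<Union>i\<in>{..<q} - stars. E i)"
  proof
    fix e assume e: "e \<in> {e. e \<subseteq> R \<and> card e = 2}"
    then have en: "e \<subseteq> {..<n}" by (auto simp: R_def)
    then have "e \<in> E (col e)" using e by (simp add: E_def)
    moreover have "col e \<notin> stars" using e centre[OF _ \<open>e \<in> E (col e)\<close>] by (auto simp: R_def)
    ultimately show "e \<in> (\<Union>i\<in>{..<q} - stars. E i)" using col[OF en] e by auto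
  qed
  then have "card {e. e \<subseteq> R \<and> card e = 2} \<le> card (\<Union>i\<in>{..<q} - stars. E i)"
    by (rule card_mono[rotated]) (use small in auto)
  also have "\<dots> \<le> (\<Sum>i\<in>{..<q} - stars. card (E i))" by (rule card_UN_le) simp
  also have "\<dots> \<le> (\<Sum>i\<in>{..<q} - stars. 3)" using small by (intro sum_mono) auto
  also have "\<dots> = 3 * (q - card stars)" using finS sq by (simp add: card_Diff_subset)
  finally have "card R choose 2 \<le> 3 * (q - card stars)" by (simp add: n_subsets R_def)
  moreover have "card R * (card R - 1) = 2 * (card R choose 2)"
  proof -
    have "even (card R * (card R - 1))" by (cases "card R") auto
    then show ?thesis unfolding choose_two by (rule dvd_mult_div_cancel[symmetric])
  qed
  ultimately have "card R * (card R - 1) \<le> 6 * (q - card stars)" by linarith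
  moreover have "6 * card R \<le> card R * (card R - 1) + 12"
  proof -
    have "0 \<le> (int r - 3) * (int r - 4)" for r :: nat
      by (cases "r \<le> 3") (auto intro: mult_nonneg_nonneg mult_nonpos_nonpos)
    from this[of "card R"] have "6 * int (card R) \<le> int (card R) * (int (card R) - 1) + 12"
      by (simp add: algebra_simps)
    moreover have "int (card R * (card R - 1)) = int (card R) * (int (card R) - 1)"
      by (cases "card R") (simp_all add: algebra_simps)
    ultimately show ?thesis by linarith
  qed
  moreover have "card stars \<le> q" using card_mono[OF _ sq] by simp
  moreover have "n - card stars \<le> card R"
  proof -
    have "n - card (centre ` stars) \<le> card R" unfolding R_def
      using diff_card_le_card_Diff[of "centre ` stars" "{..<n}"] finS by simp
    then show ?thesis using card_image_le[OF finS, of centre] by linarith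
  qed
  \<comment> \<open>With \<open>r\<close> remaining points and \<open>s\<close> stars,
    \<open>6 r \<le> 6 (q - s) + 12\<close> gives \<open>r \<le> q - s + 2\<close>, and
    \<open>n \<le> r + s\<close>.\<close>
  ultimately show ?thesis by linarith
qed

section \<open>Points of the twisted cubic in homogeneous coordinates and the lines joining
  them\<close>

definition moment_curve :: "nat \<Rightarrow> real^4" where
  "moment_curve i = vector [1, real i, real i ^ 2, real i ^ 3]"

text \<open>Combining the four coordinates with the coefficients of
  \<open>(x - j) (x - k) (x - l)\<close> kills the terms of \<open>j\<close>, \<open>k\<close> and
  \<open>l\<close> and leaves \<open>a\<close> times a nonzero product: Vandermonde independence,
  arranged for comparing two pairs.\<close>

lemma moment_curve_independent:
  assumes "distinct [i, j, k, l]"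
    and "a *\<^sub>R moment_curve i + b *\<^sub>R moment_curve j = c *\<^sub>R moment_curve k + d *\<^sub>R moment_curve l"
  shows "a = 0"
proof -
  have "a + b - c - d = 0"
    "a * i + b * j - c * k - d * l = 0"
    "a * real i ^ 2 + b * real j ^ 2 - c * real k ^ 2 - d * real l ^ 2 = 0"
    "a * real i ^ 3 + b * real j ^ 3 - c * real k ^ 3 - d * real l ^ 3 = 0"
    using arg_cong[OF assms(2), of "\<lambda>v. v $ 1"] arg_cong[OF assms(2), of "\<lambda>v. v $ 2"]
      arg_cong[OF assms(2), of "\<lambda>v. v $ 3"] arg_cong[OF assms(2), of "\<lambda>v. v $ 4"]
    by (simp_all add: moment_curve_def vector_def)
  then have "a * ((real i - real j) * (real i - real k) * (real i - real l)) = 0" by algebra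
  then show ?thesis using assms(1) by simp
qed

definition pair_span :: "nat set \<Rightarrow> (real^4) set" where
  "pair_span e = span (moment_curve ` e)"

definition pair_line :: "nat set \<Rightarrow> (real^4) set set" where
  "pair_line e = {p \<in> projective_points. p \<subseteq> pair_span e}"

lemma moment_curve_nonzero: "moment_curve i \<noteq> 0"
proof
  assume "moment_curve i = 0"
  then have "moment_curve i $ 1 = 0" by simp
  then show False by (simp add: moment_curve_def vector_def)
qed

text \<open>Completes a pair of indices to four distinct ones, so that independence of four curve
  points also yields independence of two.\<close>

lemma fresh_index: "\<exists>k::nat. k \<noteq> i \<and> k \<noteq> j \<and> k \<noteq> l"
  using ex_new_if_finite[of "{i, j, l}"] by auto

lemma pair_span_disjoint:
  assumes "card e = 2" "card f = 2" "e \<inter> f = {}"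
  shows "pair_span e \<inter> pair_span f \<subseteq> {0}"
proof
  fix x assume x: "x \<in> pair_span e \<inter> pair_span f"
  obtain i j where ij: "e = {i, j}" "i \<noteq> j" using assms(1) by (auto simp: card_2_iff)
  obtain k l where kl: "f = {k, l}" "k \<noteq> l" using assms(2) by (auto simp: card_2_iff)
  obtain a b where ab: "x = a *\<^sub>R moment_curve i + b *\<^sub>R moment_curve j"
    using x by (auto simp: ij pair_span_def span_insert span_empty algebra_simps)
  obtain c d where cd: "x = c *\<^sub>R moment_curve k + d *\<^sub>R moment_curve l"
    using x by (auto simp: kl pair_span_def span_insert span_empty algebra_simps)
  have dist: "distinct [i, j, k, l]" using assms(3) ij kl by auto
  have "a = 0" by (rule moment_curve_independent[OF dist, of a b c d]) (use ab cd in simp)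
  moreover have "b = 0"
    by (rule moment_curve_independent[of j i k l b a c d]) (use dist ab cd in \<open>auto simp: add.commute\<close>)
  ultimately show "x \<in> {0}" using ab by simp
qed

lemma projective_line_pair_line:
  assumes "card e = 2"
  shows "projective_line (pair_line e)"
proof -
  obtain i j where ij: "e = {i, j}" "i \<noteq> j" using assms(1) by (auto simp: card_2_iff)
  obtain k where k: "k \<noteq> i" "k \<noteq> j" using fresh_index by blast
  obtain l where l: "l \<noteq> i" "l \<noteq> j" "l \<noteq> k" using fresh_index by blast
  have ne: "moment_curve i \<noteq> moment_curve j"
    using moment_curve_independent[of i j k l 1 "-1" 0 0] ij k l by auto
  have "moment_curve i \<noteq> c *\<^sub>R moment_curve j" for c
    using moment_curve_independent[of i j k l 1 "-c" 0 0] ij k l by auto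
  then have "independent {moment_curve i, moment_curve j}"
    using ne moment_curve_nonzero
    by (auto simp: independent_insert dependent_single span_singleton)
  then have "dim (pair_span e) = 2"
    using ne by (simp add: pair_span_def ij dim_span dim_eq_card_independent)
  then show ?thesis
    unfolding projective_line_def pair_line_def by (intro exI[of _ "pair_span e"]) (simp add: pair_span_def)
qed

text \<open>A common index gives a common projective point, the span of its curve point. Disjoint
  pairs span planes through the origin that meet only in 0, which leaves no room for a
  one-dimensional subspace.\<close>

lemma disjnt_pair_line:
  assumes "card e = 2" "card f = 2"
  shows "disjnt (pair_line e) (pair_line f) \<longleftrightarrow> e \<inter> f = {}"
proof
  assume dis: "disjnt (pair_line e) (pair_line f)"
  show "e \<inter> f = {}"
  proof (rule ccontr)
    assume "e \<inter> f \<noteq> {}"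
    then obtain i where i: "i \<in> e" "i \<in> f" by blast
    have "span {moment_curve i} \<in> projective_points"
      using moment_curve_nonzero[of i]
      by (simp add: projective_points_def dim_span dim_eq_card_independent dependent_single)
    moreover have "span {moment_curve i} \<subseteq> pair_span e" "span {moment_curve i} \<subseteq> pair_span f"
      unfolding pair_span_def using i by (auto intro!: span_mono)
    ultimately show False using dis unfolding disjnt_def pair_line_def by blast
  qed
next
  assume "e \<inter> f = {}"
  then have sub: "pair_span e \<inter> pair_span f \<subseteq> {0}" by (rule pair_span_disjoint[OF assms])
  have "p \<notin> pair_line f" if "p \<in> pair_line e" for p
  proof
    assume "p \<in> pair_line f"
    then have "p \<subseteq> {0}" using that sub unfolding pair_line_def by blast
    then have "dim p \<le> dim {0 :: real^4}" by (rule dim_subset)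
    moreover have "dim p = 1" using that by (auto simp: pair_line_def projective_points_def)
    ultimately show False by simp
  qed
  then show "disjnt (pair_line e) (pair_line f)" unfolding disjnt_def by blast
qed

lemma projective_lines_ratio:
  assumes "0 < k"
  shows "\<exists>F :: (real^4) set set set. finite F \<and> (\<forall>L\<in>F. projective_line L) \<and>
    clique_number F (disjointness_edges F) = k \<and> chromatic_number F (disjointness_edges F) = 2 * k - 1"
proof -
  define n where "n = 2 * k + 1"
  define P where "P = {e. e \<subseteq> {..<n} \<and> card e = 2}"
  define F where "F = pair_line ` P"
  have finP: "finite P" by (simp add: P_def)
  then have finF: "finite F" by (simp add: F_def)
  have proj: "projective_line L" if "L \<in> F" for L
    using that projective_line_pair_line by (auto simp: F_def P_def)
  define ed where "ed L = (SOME e. e \<in> P \<and> pair_line e = L)" for L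
  have ed: "ed L \<in> P" "pair_line (ed L) = L" if "L \<in> F" for L
  proof -
    have "\<exists>e. e \<in> P \<and> pair_line e = L" using that by (auto simp: F_def)
    from someI_ex[OF this] show "ed L \<in> P" "pair_line (ed L) = L" unfolding ed_def by auto
  qed
  have disj: "disjnt (pair_line e) (pair_line f) \<longleftrightarrow> e \<inter> f = {}" if "e \<in> P" "f \<in> P" for e f
    using that disjnt_pair_line by (simp add: P_def)
  have ed_disj: "disjnt L M \<longleftrightarrow> ed L \<inter> ed M = {}" if "L \<in> F" "M \<in> F" for L M
    using disj[OF ed(1)[OF that(1)] ed(1)[OF that(2)]] ed(2)[OF that(1)] ed(2)[OF that(2)] by simp

  have "clique_number F (disjointness_edges F) \<le> k"
  proof -
    obtain K where K: "K \<subseteq> F" "clique K (disjointness_edges F)"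
      "card K = clique_number F (disjointness_edges F)"
      using clique_number_obtain[OF finF] by blast
    have "card (\<Union>L\<in>K. ed L) = (\<Sum>L\<in>K. card (ed L))"
    proof (rule card_UN_disjoint)
      show "finite K" using K(1) finF by (rule finite_subset)
      show "\<forall>L\<in>K. finite (ed L)"
        using ed(1) K(1) unfolding P_def by (metis (no_types, lifting) finite_lessThan finite_subset mem_Collect_eq subsetD)
      show "\<forall>L\<in>K. \<forall>M\<in>K. L \<noteq> M \<longrightarrow> ed L \<inter> ed M = {}"
        using clique_disjnt[OF K(2,1)] ed_disj K(1) by blast
    qed
    also have "\<dots> = (\<Sum>L\<in>K. 2)" using ed(1) K(1) by (intro sum.cong) (auto simp: P_def)
    finally have "card (\<Union>L\<in>K. ed L) = 2 * card K" by simp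
    moreover have "(\<Union>L\<in>K. ed L) \<subseteq> {..<n}" using ed(1) K(1) by (force simp: P_def)
    then have "card (\<Union>L\<in>K. ed L) \<le> n" using card_mono[of "{..<n}"] by simp
    ultimately show ?thesis using K(3) by (simp add: n_def)
  qed
  moreover have "k \<le> clique_number F (disjointness_edges F)"
  proof -
    \<comment> \<open>The \<open>k\<close> disjoint pairs use the points below \<open>2 * k\<close>;
      the last point \<open>2 * k\<close> stays unmatched.\<close>
    define e where "e i = {2 * i, 2 * i + 1}" for i :: nat
    have eP: "e i \<in> P" if "i < k" for i using that by (auto simp: e_def P_def n_def)
    have e_dis: "disjnt (pair_line (e i)) (pair_line (e j))" if "i < k" "j < k" "i \<noteq> j" for i j
    proof -
      have "e i \<inter> e j = {}" using that(3) unfolding e_def by (auto; presburger)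
      then show ?thesis using disj eP that by blast
    qed
    have nonempty: "pair_line (e i) \<noteq> pair_line (e j)" if "i < k" "j < k" "i \<noteq> j" for i j
    proof
      assume "pair_line (e i) = pair_line (e j)"
      then have "disjnt (pair_line (e i)) (pair_line (e i))" using e_dis[OF that] by simp
      then have "e i \<inter> e i = {}" using disj eP that by blast
      then show False by (simp add: e_def)
    qed
    let ?K = "(\<lambda>i. pair_line (e i)) ` {..<k}"
    have KF: "?K \<subseteq> F" using eP by (auto simp: F_def)
    have "clique ?K (disjointness_edges F)"
      unfolding clique_def
    proof (intro ballI impI)
      fix L M assume LM: "L \<in> ?K" "M \<in> ?K" "L \<noteq> M"
      then have "disjnt L M" using e_dis by blast
      then show "{L, M} \<in> disjointness_edges F" using LM KF by (subst disjointness_edges_iff) auto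
    qed
    then have "card ?K \<le> clique_number F (disjointness_edges F)"
      by (rule card_le_clique_number[OF finF KF])
    moreover have "inj_on (\<lambda>i. pair_line (e i)) {..<k}"
      using nonempty by (auto simp: inj_on_def)
    ultimately show ?thesis by (simp add: card_image)
  qed
  moreover have "chromatic_number F (disjointness_edges F) \<le> 2 * k - 1"
  proof -
    \<comment> \<open>The colours below \<open>n - 3\<close> are stars centred at the minimum;
      colour \<open>n - 3\<close> collects the pairs inside the last three points, which form a
      triangle. This makes \<open>n - 2 = 2 * k - 1\<close> colours.\<close>
    define col where "col L = min (Min (ed L)) (n - 3)" for L
    have "proper_colouring F (disjointness_edges F) (2 * k - 1) col"
      unfolding proper_colouring_def
    proof (intro conjI ballI impI)
      show "col ` F \<subseteq> {..<2 * k - 1}" using assms by (auto simp: col_def n_def)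
      fix L M assume LM: "L \<in> F" "M \<in> F" "{L, M} \<in> disjointness_edges F"
      then have dis: "ed L \<inter> ed M = {}" using ed_disj disjointness_edges_iff[OF LM(1,2)] by simp
      show "col L \<noteq> col M"
      proof
        assume eq: "col L = col M"
        have edL: "finite (ed L)" "ed L \<noteq> {}" "ed L \<subseteq> {..<n}" "card (ed L) = 2"
          and edM: "finite (ed M)" "ed M \<noteq> {}" "ed M \<subseteq> {..<n}" "card (ed M) = 2"
          using ed(1)[OF LM(1)] ed(1)[OF LM(2)] by (auto simp: P_def intro: finite_subset)
        have "Min (ed L) \<in> ed L" "Min (ed M) \<in> ed M" using edL edM by auto
        then have "Min (ed L) \<noteq> Min (ed M)" using dis by auto
        then have ge: "n - 3 \<le> Min (ed L)" "n - 3 \<le> Min (ed M)" using eq unfolding col_def by linarith+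
        have "ed L \<subseteq> {n - 3..<n}" "ed M \<subseteq> {n - 3..<n}"
          using ge edL edM Min_le order_trans by fastforce+
        then have "card (ed L \<union> ed M) \<le> 3" using card_mono[of "{n - 3..<n}" "ed L \<union> ed M"] by simp
        moreover have "card (ed L \<union> ed M) = 4" using card_Un_disjoint[OF edL(1) edM(1) dis] edL edM by simp
        ultimately show False by simp
      qed
    qed
    then show ?thesis by (rule chromatic_number_le)
  qed
  moreover have "2 * k - 1 \<le> chromatic_number F (disjointness_edges F)"
  proof -
    obtain c where c: "proper_colouring F (disjointness_edges F) (chromatic_number F (disjointness_edges F)) c"
      by (rule chromatic_number_colouring[OF finF])
    have "n \<le> chromatic_number F (disjointness_edges F) + 2"
    proof (rule kneser_pairs_colours[where col = "\<lambda>e. c (pair_line e)"])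
      show "c (pair_line e) < chromatic_number F (disjointness_edges F)"
        if "e \<subseteq> {..<n}" "card e = 2" for e
        using c that unfolding proper_colouring_def F_def P_def by auto
      fix e f assume ef: "e \<subseteq> {..<n}" "f \<subseteq> {..<n}" "card e = 2" "card f = 2"
        "c (pair_line e) = c (pair_line f)"
      show "e \<inter> f \<noteq> {}"
      proof
        assume dis: "e \<inter> f = {}"
        have P: "e \<in> P" "f \<in> P" using ef by (auto simp: P_def)
        then have F: "pair_line e \<in> F" "pair_line f \<in> F" by (auto simp: F_def)
        have d: "disjnt (pair_line e) (pair_line f)" using disj P dis by simp
        moreover have "pair_line e \<noteq> pair_line f"
        proof
          assume "pair_line e = pair_line f"
          then have "e \<inter> e = {}" using d disj[OF P(1) P(1)] by simp
          then show False using ef(3) by simp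
        qed
        ultimately have "{pair_line e, pair_line f} \<in> disjointness_edges F"
          using F by (simp add: disjointness_edges_iff)
        then show False using c F ef(5) unfolding proper_colouring_def by blast
      qed
    qed
    then show ?thesis by (simp add: n_def)
  qed
  ultimately show ?thesis using finF proj by (intro exI[of _ F]) auto
qed

theorem theorem2p3:
  shows "(\<forall>M::real. M > 0 \<longrightarrow>
            (\<exists>F :: (real^3) set set. finite F \<and> (\<forall>L\<in>F. affine_line L) \<and>
               real (chromatic_number F (disjointness_edges F)) /
               real (clique_number F (disjointness_edges F)) > M)) \<and>
         (\<forall>k::nat. k > 0 \<longrightarrow>
            (\<exists>F :: (real^4) set set set. finite F \<and> (\<forall>L\<in>F. projective_line L) \<and>
               clique_number F (disjointness_edges F) = k \<and>
               chromatic_number F (disjointness_edges F) = 2 * k - 1))"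
  using affine_lines_ratio projective_lines_ratio by simp

end
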